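(* The blocked-braid group $\mathbf{BB}_2$ is isomorphic to $\mathbb{Z}_2$, the cyclic group of order $2$.
   Context: Composition of arrows is written by juxtaposition, $fg$ meaning first $g$, then $f$. A braided strict monoidal category is a category with a strictly associative and unitary tensor functor $\otimes$ with unit $I$, and a natural family of isomorphisms (twist) $\tau_{A,B}:A\otimes B\to B\otimes A$ such that $\tau_{A,B\otimes C}=(1_B\otimes\tau_{A,C})(\tau_{A,B}\otimes 1_C)$ and $\tau_{A\otimes B,C}=(\tau_{A,C}\otimes 1_B)(1_A\otimes\tau_{B,C})$. $A^n$ denotes the $n$-fold tensor power of $A$. A tangle algebra in such a category is an object $A$ with arrows $\eta:I\to A\otimes A$ and $\epsilon:A\otimes A\to I$ satisfying $(\epsilon\otimes 1_A)(1_A\otimes\eta)=1_A=(1_A\otimes\epsilon)(\eta\otimes 1_A)$, $\epsilon\tau_{A,A}=\epsilon$ and $\tau_{A,A}\eta=\eta$. $\mathbf{Tangle}_n$ is the free braided strict monoidal category generated by an object $A$ with a tangle algebra structure and two arrows $R:I\to A^n$ and $S:A^n\to I$ (subject to no further equations). A braid in $\mathbf{Tangle}_n$ is an arrow $B:A^n\to A^n$ that is a composite of arrows each of which is a tensor of identities and arrows $\tau_{A,A}$ or $\tau_{A,A}^{-1}$. A blocked braid on $n$ strings is an arrow $I\to I$ of $\mathbf{Tangle}_n$ of the form $SBR$ with $B$ a braid; equality of blocked braids is equality of arrows in $\mathbf{Tangle}_n$. The blocked-braid group $\mathbf{BB}_n$ has as elements the blocked braids on $n$ strings, identity $S1_{A^n}R$,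 product $(SBR)(SB'R)=SBB'R$ and inverse $(SBR)^{-1}=SB^{-1}R$ (these operations are well defined). *)

theory Defs
  imports "HOL-Algebra.Elementary_Groups"
begin

section \<open>Braided strict monoidal categories\<close>

text \<open>
  Composition is written in applicative order: \<open>g \<cdot> f\<close> is first \<open>f\<close>, then \<open>g\<close>.
\<close>

record ('o, 'm) monoidal_data =
  Obj :: "'o set"
  Arr :: "'m set"
  Dom :: "'m \<Rightarrow> 'o"
  Cod :: "'m \<Rightarrow> 'o"
  Ident :: "'o \<Rightarrow> 'm"
  Cmp :: "'m \<Rightarrow> 'm \<Rightarrow> 'm"  (infixr "\<cdot>\<index>" 70)
  Unit :: "'o"
  TensObj :: "'o \<Rightarrow> 'o \<Rightarrow> 'o"  (infixr "\<star>\<index>" 75)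
  TensArr :: "'m \<Rightarrow> 'm \<Rightarrow> 'm"  (infixr "\<boxtimes>\<index>" 75)
  Twist :: "'o \<Rightarrow> 'o \<Rightarrow> 'm"

definition Hom :: "('o, 'm, 'x) monoidal_data_scheme \<Rightarrow> 'o \<Rightarrow> 'o \<Rightarrow> 'm set" where
  "Hom C a b = {f \<in> Arr C. Dom C f = a \<and> Cod C f = b}"

definition inverse_arrows :: "('o, 'm, 'x) monoidal_data_scheme \<Rightarrow> 'm \<Rightarrow> 'm \<Rightarrow> bool" where
  "inverse_arrows C f g \<longleftrightarrow>
     f \<in> Arr C \<and> g \<in> Hom C (Cod C f) (Dom C f) \<and>
     g \<cdot>\<^bsub>C\<^esub> f = Ident C (Dom C f) \<and> f \<cdot>\<^bsub>C\<^esub> g = Ident C (Cod C f)"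

locale braided_strict_monoidal_category =
  fixes C :: "('o, 'm, 'x) monoidal_data_scheme" (structure)
  assumes Dom_Obj: "f \<in> Arr C \<Longrightarrow> Dom C f \<in> Obj C"
    and Cod_Obj: "f \<in> Arr C \<Longrightarrow> Cod C f \<in> Obj C"
    and Ident_Hom: "a \<in> Obj C \<Longrightarrow> Ident C a \<in> Hom C a a"
    and Cmp_Hom: "f \<in> Hom C a b \<Longrightarrow> g \<in> Hom C b c \<Longrightarrow> g \<cdot> f \<in> Hom C a c"
    and Cmp_Ident_left: "f \<in> Hom C a b \<Longrightarrow> Ident C b \<cdot> f = f"
    and Cmp_Ident_right: "f \<in> Hom C a b \<Longrightarrow> f \<cdot> Ident C a = f"
    and Cmp_assoc: "f \<in> Hom C a b \<Longrightarrow> g \<in> Hom C b c \<Longrightarrow> h \<in> Hom C c d \<Longrightarrow>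
      (h \<cdot> g) \<cdot> f = h \<cdot> (g \<cdot> f)"
    and Unit_Obj: "Unit C \<in> Obj C"
    and TensObj_Obj: "a \<in> Obj C \<Longrightarrow> b \<in> Obj C \<Longrightarrow> a \<star> b \<in> Obj C"
    and TensArr_Hom: "f \<in> Hom C a b \<Longrightarrow> g \<in> Hom C c d \<Longrightarrow> f \<boxtimes> g \<in> Hom C (a \<star> c) (b \<star> d)"
    and TensArr_Ident: "a \<in> Obj C \<Longrightarrow> b \<in> Obj C \<Longrightarrow> Ident C a \<boxtimes> Ident C b = Ident C (a \<star> b)"
    and TensArr_Cmp: "f \<in> Hom C a b \<Longrightarrow> g \<in> Hom C b c \<Longrightarrow> f' \<in> Hom C a' b' \<Longrightarrow> g' \<in> Hom C b' c' \<Longrightarrow>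
      (g \<cdot> f) \<boxtimes> (g' \<cdot> f') = (g \<boxtimes> g') \<cdot> (f \<boxtimes> f')"
    and TensObj_assoc: "a \<in> Obj C \<Longrightarrow> b \<in> Obj C \<Longrightarrow> c \<in> Obj C \<Longrightarrow> (a \<star> b) \<star> c = a \<star> (b \<star> c)"
    and TensObj_Unit_left: "a \<in> Obj C \<Longrightarrow> Unit C \<star> a = a"
    and TensObj_Unit_right: "a \<in> Obj C \<Longrightarrow> a \<star> Unit C = a"
    and TensArr_assoc: "f \<in> Arr C \<Longrightarrow> g \<in> Arr C \<Longrightarrow> h \<in> Arr C \<Longrightarrow> (f \<boxtimes> g) \<boxtimes> h = f \<boxtimes> (g \<boxtimes> h)"
    and TensArr_Unit_left: "f \<in> Arr C \<Longrightarrow> Ident C (Unit C) \<boxtimes> f = f"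
    and TensArr_Unit_right: "f \<in> Arr C \<Longrightarrow> f \<boxtimes> Ident C (Unit C) = f"
    and Twist_Hom: "a \<in> Obj C \<Longrightarrow> b \<in> Obj C \<Longrightarrow> Twist C a b \<in> Hom C (a \<star> b) (b \<star> a)"
    and Twist_iso: "a \<in> Obj C \<Longrightarrow> b \<in> Obj C \<Longrightarrow> \<exists>g. inverse_arrows C (Twist C a b) g"
    and Twist_natural: "f \<in> Hom C a a' \<Longrightarrow> g \<in> Hom C b b' \<Longrightarrow>
      (g \<boxtimes> f) \<cdot> Twist C a b = Twist C a' b' \<cdot> (f \<boxtimes> g)"
    and Twist_tensor_right: "a \<in> Obj C \<Longrightarrow> b \<in> Obj C \<Longrightarrow> c \<in> Obj C \<Longrightarrow>
      Twist C a (b \<star> c) = (Ident C b \<boxtimes> Twist C a c) \<cdot> (Twist C a b \<boxtimes> Ident C c)"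
    and Twist_tensor_left: "a \<in> Obj C \<Longrightarrow> b \<in> Obj C \<Longrightarrow> c \<in> Obj C \<Longrightarrow>
      Twist C (a \<star> b) c = (Twist C a c \<boxtimes> Ident C b) \<cdot> (Ident C a \<boxtimes> Twist C b c)"

fun tensor_power :: "('o, 'm, 'x) monoidal_data_scheme \<Rightarrow> 'o \<Rightarrow> nat \<Rightarrow> 'o" where
  "tensor_power C A 0 = Unit C"
| "tensor_power C A (Suc k) = A \<star>\<^bsub>C\<^esub> tensor_power C A k"

locale tangle_algebra = braided_strict_monoidal_category C
  for C :: "('o, 'm, 'x) monoidal_data_scheme" (structure) and A :: 'o and \<eta> :: 'm and \<epsilon> :: 'm +
  assumes A_Obj: "A \<in> Obj C"
    and eta_Hom: "\<eta> \<in> Hom C (Unit C) (A \<star> A)"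
    and eps_Hom: "\<epsilon> \<in> Hom C (A \<star> A) (Unit C)"
    and zigzag_left: "(\<epsilon> \<boxtimes> Ident C A) \<cdot> (Ident C A \<boxtimes> \<eta>) = Ident C A"
    and zigzag_right: "(Ident C A \<boxtimes> \<epsilon>) \<cdot> (\<eta> \<boxtimes> Ident C A) = Ident C A"
    and eps_Twist: "\<epsilon> \<cdot> Twist C A A = \<epsilon>"
    and Twist_eta: "Twist C A A \<cdot> \<eta> = \<eta>"

locale blocked_tangle_algebra = tangle_algebra C A \<eta> \<epsilon>
  for C :: "('o, 'm, 'x) monoidal_data_scheme" (structure) and A \<eta> \<epsilon> +
  fixes n :: nat and R :: 'm and S :: 'm
  assumes R_Hom: "R \<in> Hom C (Unit C) (tensor_power C A n)"
    and S_Hom: "S \<in> Hom C (tensor_power C A n) (Unit C)"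

locale strict_braided_functor =
  source: braided_strict_monoidal_category C + target: braided_strict_monoidal_category D
  for C :: "('o, 'm, 'x) monoidal_data_scheme" and D :: "('p, 'k, 'y) monoidal_data_scheme" +
  fixes Fo :: "'o \<Rightarrow> 'p" and Fa :: "'m \<Rightarrow> 'k"
  assumes F_Obj: "a \<in> Obj C \<Longrightarrow> Fo a \<in> Obj D"
    and F_Hom: "f \<in> Hom C a b \<Longrightarrow> Fa f \<in> Hom D (Fo a) (Fo b)"
    and F_Ident: "a \<in> Obj C \<Longrightarrow> Fa (Ident C a) = Ident D (Fo a)"
    and F_Cmp: "f \<in> Hom C a b \<Longrightarrow> g \<in> Hom C b c \<Longrightarrow> Fa (g \<cdot>\<^bsub>C\<^esub> f) = Fa g \<cdot>\<^bsub>D\<^esub> Fa f"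
    and F_Unit: "Fo (Unit C) = Unit D"
    and F_TensObj: "a \<in> Obj C \<Longrightarrow> b \<in> Obj C \<Longrightarrow> Fo (a \<star>\<^bsub>C\<^esub> b) = Fo a \<star>\<^bsub>D\<^esub> Fo b"
    and F_TensArr: "f \<in> Arr C \<Longrightarrow> g \<in> Arr C \<Longrightarrow> Fa (f \<boxtimes>\<^bsub>C\<^esub> g) = Fa f \<boxtimes>\<^bsub>D\<^esub> Fa g"
    and F_Twist: "a \<in> Obj C \<Longrightarrow> b \<in> Obj C \<Longrightarrow> Fa (Twist C a b) = Twist D (Fo a) (Fo b)"

lemma HomI: "f \<in> Arr C \<Longrightarrow> Dom C f = a \<Longrightarrow> Cod C f = b \<Longrightarrow> f \<in> Hom C a b"
  by (simp add: Hom_def)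

lemma HomD:
  assumes "f \<in> Hom C a b"
  shows "f \<in> Arr C" "Dom C f = a" "Cod C f = b"
  using assms by (simp_all add: Hom_def)

lemma Arr_Hom: "f \<in> Arr C \<Longrightarrow> f \<in> Hom C (Dom C f) (Cod C f)"
  by (simp add: Hom_def)

context braided_strict_monoidal_category
begin

lemma tensor_power_Obj: "A \<in> Obj C \<Longrightarrow> tensor_power C A k \<in> Obj C"
  by (induction k) (simp_all add: Unit_Obj TensObj_Obj)

lemma tensor_power_add:
  "A \<in> Obj C \<Longrightarrow> tensor_power C A (j + k) = tensor_power C A j \<star> tensor_power C A k"
  by (induction j) (simp_all add: TensObj_Unit_left TensObj_assoc tensor_power_Obj)

lemma inverse_arrows_sym: "inverse_arrows C f g \<Longrightarrow> inverse_arrows C g f"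
  by (auto simp: inverse_arrows_def Hom_def)

lemma inverse_arrows_unique:
  assumes "inverse_arrows C f g" "inverse_arrows C f h"
  shows "g = h"
proof -
  let ?a = "Dom C f" and ?b = "Cod C f"
  have f: "f \<in> Hom C ?a ?b" and g: "g \<in> Hom C ?b ?a" and h: "h \<in> Hom C ?b ?a"
    using assms by (auto simp: inverse_arrows_def Arr_Hom)
  have "g = g \<cdot> (f \<cdot> h)"
    using assms g by (simp add: inverse_arrows_def Cmp_Ident_right)
  also have "\<dots> = (g \<cdot> f) \<cdot> h"
    using Cmp_assoc[OF h f g] by simp
  also have "\<dots> = h"
    using assms h by (simp add: inverse_arrows_def Cmp_Ident_left)
  finally show ?thesis .
qed

lemma inverse_arrows_Cmp:
  assumes "inverse_arrows C f f'" "inverse_arrows C g g'" "Dom C g = Cod C f"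
  shows "inverse_arrows C (g \<cdot> f) (f' \<cdot> g')"
proof -
  let ?a = "Dom C f" and ?b = "Cod C f" and ?c = "Cod C g"
  have f: "f \<in> Hom C ?a ?b" "f' \<in> Hom C ?b ?a"
    and g: "g \<in> Hom C ?b ?c" "g' \<in> Hom C ?c ?b"
    using assms by (auto simp: inverse_arrows_def Hom_def)
  have e: "f' \<cdot> f = Ident C ?a" "f \<cdot> f' = Ident C ?b" "g' \<cdot> g = Ident C ?b" "g \<cdot> g' = Ident C ?c"
    using assms by (auto simp: inverse_arrows_def)
  have "(f' \<cdot> g') \<cdot> (g \<cdot> f) = f' \<cdot> ((g' \<cdot> g) \<cdot> f)"
    using Cmp_assoc[OF Cmp_Hom[OF f(1) g(1)] g(2) f(2)] Cmp_assoc[OF f(1) g(1) g(2)] by simp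
  then have 1: "(f' \<cdot> g') \<cdot> (g \<cdot> f) = Ident C ?a"
    using e Cmp_Ident_left[OF f(1)] by simp
  have "(g \<cdot> f) \<cdot> (f' \<cdot> g') = g \<cdot> ((f \<cdot> f') \<cdot> g')"
    using Cmp_assoc[OF Cmp_Hom[OF g(2) f(2)] f(1) g(1)] Cmp_assoc[OF g(2) f(2) f(1)] by simp
  then have 2: "(g \<cdot> f) \<cdot> (f' \<cdot> g') = Ident C ?c"
    using e Cmp_Ident_left[OF g(2)] by simp
  show ?thesis
    unfolding inverse_arrows_def
    using 1 2 HomD[OF Cmp_Hom[OF f(1) g(1)]] Cmp_Hom[OF g(2) f(2)] by simp
qed

lemma inverse_arrows_TensArr:
  assumes "inverse_arrows C f f'" "inverse_arrows C g g'"
  shows "inverse_arrows C (f \<boxtimes> g) (f' \<boxtimes> g')"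
proof -
  let ?a = "Dom C f" and ?b = "Cod C f" and ?c = "Dom C g" and ?d = "Cod C g"
  have f: "f \<in> Hom C ?a ?b" "f' \<in> Hom C ?b ?a"
    and g: "g \<in> Hom C ?c ?d" "g' \<in> Hom C ?d ?c"
    using assms by (auto simp: inverse_arrows_def Hom_def)
  have o: "?a \<in> Obj C" "?b \<in> Obj C" "?c \<in> Obj C" "?d \<in> Obj C"
    using HomD(1)[OF f(1)] HomD(1)[OF g(1)] by (simp_all add: Dom_Obj Cod_Obj)
  have e: "f' \<cdot> f = Ident C ?a" "f \<cdot> f' = Ident C ?b" "g' \<cdot> g = Ident C ?c" "g \<cdot> g' = Ident C ?d"
    using assms by (auto simp: inverse_arrows_def)
  show ?thesis
    unfolding inverse_arrows_def
    using HomD[OF TensArr_Hom[OF f(1) g(1)]] TensArr_Hom[OF f(2) g(2)] o e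
      TensArr_Cmp[OF f(1) f(2) g(1) g(2)] TensArr_Cmp[OF f(2) f(1) g(2) g(1)]
    by (simp add: TensArr_Ident)
qed

lemma inverse_arrows_Ident: "a \<in> Obj C \<Longrightarrow> inverse_arrows C (Ident C a) (Ident C a)"
  using Ident_Hom[of a] Cmp_Ident_left[OF Ident_Hom, of a]
  by (auto simp: inverse_arrows_def Hom_def)

end

lemma (in strict_braided_functor) F_inverse_arrows:
  assumes "inverse_arrows C f g"
  shows "inverse_arrows D (Fa f) (Fa g)"
proof -
  let ?a = "Dom C f" and ?b = "Cod C f"
  have f: "f \<in> Hom C ?a ?b" and g: "g \<in> Hom C ?b ?a"
    using assms by (auto simp: inverse_arrows_def Hom_def)
  show ?thesis
    unfolding inverse_arrows_def
    using assms HomD[OF F_Hom[OF f]] F_Hom[OF g] F_Cmp[OF f g] F_Cmp[OF g f]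
      F_Ident source.Dom_Obj[OF HomD(1)[OF f]] source.Cod_Obj[OF HomD(1)[OF f]]
    by (simp add: inverse_arrows_def)
qed

section \<open>The free category \<open>Tangle\<^sub>n\<close>\<close>

text \<open>
  The objects of \<open>Tangle\<^sub>n\<close> are the tensor powers of the generating object \<open>A\<close>; the number
  \<open>k\<close> stands for \<open>A\<^sup>k\<close>, so the tensor product of objects is addition.
  Arrows are well-formed terms modulo the congruence generated by the axioms.
  The theorems \<open>Tangle_blocked_tangle_algebra\<close>, \<open>Tangle_universal\<close> and
  \<open>Tangle_functor_unique\<close> below show that this is the free category in question.
\<close>

datatype tangle_term =
    TId nat
  | TCmp tangle_term tangle_term
  | TTens tangle_term tangle_term
  | TTwist nat nat
  | TTwistInv nat nat
  | TEta
  | TEps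
  | TR
  | TS

fun tdom :: "nat \<Rightarrow> tangle_term \<Rightarrow> nat" where
  "tdom n (TId a) = a"
| "tdom n (TCmp g f) = tdom n f"
| "tdom n (TTens f g) = tdom n f + tdom n g"
| "tdom n (TTwist a b) = a + b"
| "tdom n (TTwistInv a b) = b + a"
| "tdom n TEta = 0"
| "tdom n TEps = 2"
| "tdom n TR = 0"
| "tdom n TS = n"

fun tcod :: "nat \<Rightarrow> tangle_term \<Rightarrow> nat" where
  "tcod n (TId a) = a"
| "tcod n (TCmp g f) = tcod n g"
| "tcod n (TTens f g) = tcod n f + tcod n g"
| "tcod n (TTwist a b) = b + a"
| "tcod n (TTwistInv a b) = a + b"
| "tcod n TEta = 2"
| "tcod n TEps = 0"
| "tcod n TR = n"
| "tcod n TS = 0"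

fun wf_term :: "nat \<Rightarrow> tangle_term \<Rightarrow> bool" where
  "wf_term n (TCmp g f) \<longleftrightarrow> wf_term n g \<and> wf_term n f \<and> tdom n g = tcod n f"
| "wf_term n (TTens f g) \<longleftrightarrow> wf_term n f \<and> wf_term n g"
| "wf_term n _ \<longleftrightarrow> True"

inductive tangle_eq :: "nat \<Rightarrow> tangle_term \<Rightarrow> tangle_term \<Rightarrow> bool" for n :: nat where
  refl: "wf_term n t \<Longrightarrow> tangle_eq n t t"
| sym: "tangle_eq n t u \<Longrightarrow> tangle_eq n u t"
| trans: "tangle_eq n t u \<Longrightarrow> tangle_eq n u v \<Longrightarrow> tangle_eq n t v"
| Cmp_cong: "tangle_eq n g g' \<Longrightarrow> tangle_eq n f f' \<Longrightarrow> tdom n g = tcod n f \<Longrightarrow>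
    tangle_eq n (TCmp g f) (TCmp g' f')"
| Tens_cong: "tangle_eq n f f' \<Longrightarrow> tangle_eq n g g' \<Longrightarrow> tangle_eq n (TTens f g) (TTens f' g')"
| Id_left: "wf_term n f \<Longrightarrow> tangle_eq n (TCmp (TId (tcod n f)) f) f"
| Id_right: "wf_term n f \<Longrightarrow> tangle_eq n (TCmp f (TId (tdom n f))) f"
| Cmp_assoc: "wf_term n f \<Longrightarrow> wf_term n g \<Longrightarrow> wf_term n h \<Longrightarrow>
    tdom n g = tcod n f \<Longrightarrow> tdom n h = tcod n g \<Longrightarrow>
    tangle_eq n (TCmp (TCmp h g) f) (TCmp h (TCmp g f))"
| Tens_Id: "tangle_eq n (TTens (TId a) (TId b)) (TId (a + b))"
| Tens_Cmp: "wf_term n f \<Longrightarrow> wf_term n g \<Longrightarrow> wf_term n f' \<Longrightarrow> wf_term n g' \<Longrightarrow>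
    tdom n g = tcod n f \<Longrightarrow> tdom n g' = tcod n f' \<Longrightarrow>
    tangle_eq n (TTens (TCmp g f) (TCmp g' f')) (TCmp (TTens g g') (TTens f f'))"
| Tens_assoc: "wf_term n f \<Longrightarrow> wf_term n g \<Longrightarrow> wf_term n h \<Longrightarrow>
    tangle_eq n (TTens (TTens f g) h) (TTens f (TTens g h))"
| Tens_unit_left: "wf_term n f \<Longrightarrow> tangle_eq n (TTens (TId 0) f) f"
| Tens_unit_right: "wf_term n f \<Longrightarrow> tangle_eq n (TTens f (TId 0)) f"
| Twist_inv_left: "tangle_eq n (TCmp (TTwistInv a b) (TTwist a b)) (TId (a + b))"
| Twist_inv_right: "tangle_eq n (TCmp (TTwist a b) (TTwistInv a b)) (TId (b + a))"
| Twist_natural: "wf_term n f \<Longrightarrow> wf_term n g \<Longrightarrow>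
    tangle_eq n (TCmp (TTens g f) (TTwist (tdom n f) (tdom n g)))
                (TCmp (TTwist (tcod n f) (tcod n g)) (TTens f g))"
| Twist_tensor_right: "tangle_eq n (TTwist a (b + c))
    (TCmp (TTens (TId b) (TTwist a c)) (TTens (TTwist a b) (TId c)))"
| Twist_tensor_left: "tangle_eq n (TTwist (a + b) c)
    (TCmp (TTens (TTwist a c) (TId b)) (TTens (TId a) (TTwist b c)))"
| Zigzag_left: "tangle_eq n (TCmp (TTens TEps (TId 1)) (TTens (TId 1) TEta)) (TId 1)"
| Zigzag_right: "tangle_eq n (TCmp (TTens (TId 1) TEps) (TTens TEta (TId 1))) (TId 1)"
| Eps_Twist: "tangle_eq n (TCmp TEps (TTwist 1 1)) TEps"
| Twist_Eta: "tangle_eq n (TCmp (TTwist 1 1) TEta) TEta"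

definition tclass :: "nat \<Rightarrow> tangle_term \<Rightarrow> tangle_term set" where
  "tclass n t = {u. tangle_eq n t u}"

definition trep :: "tangle_term set \<Rightarrow> tangle_term" where
  "trep X = (SOME t. t \<in> X)"

definition Tangle :: "nat \<Rightarrow> (nat, tangle_term set) monoidal_data" where
  "Tangle n = \<lparr>
     Obj = UNIV,
     Arr = tclass n ` {t. wf_term n t},
     Dom = (\<lambda>X. tdom n (trep X)),
     Cod = (\<lambda>X. tcod n (trep X)),
     Ident = (\<lambda>a. tclass n (TId a)),
     Cmp = (\<lambda>Y X. tclass n (TCmp (trep Y) (trep X))),
     Unit = 0,
     TensObj = (+),
     TensArr = (\<lambda>X Y. tclass n (TTens (trep X) (trep Y))),
     Twist = (\<lambda>a b. tclass n (TTwist a b)) \<rparr>"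

abbreviation Tangle_A :: nat where
  "Tangle_A \<equiv> 1"

definition Tangle_eta :: "nat \<Rightarrow> tangle_term set" where
  "Tangle_eta n = tclass n TEta"

definition Tangle_eps :: "nat \<Rightarrow> tangle_term set" where
  "Tangle_eps n = tclass n TEps"

definition Tangle_R :: "nat \<Rightarrow> tangle_term set" where
  "Tangle_R n = tclass n TR"

definition Tangle_S :: "nat \<Rightarrow> tangle_term set" where
  "Tangle_S n = tclass n TS"

lemma tangle_eq_wf:
  "tangle_eq n t u \<Longrightarrow> wf_term n t \<and> wf_term n u \<and> tdom n t = tdom n u \<and> tcod n t = tcod n u"
  by (induction rule: tangle_eq.induct) auto

lemma tclass_eq_iff:
  assumes "wf_term n t"
  shows "tclass n t = tclass n u \<longleftrightarrow> tangle_eq n t u"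
proof
  assume "tclass n t = tclass n u"
  moreover have "t \<in> tclass n t"
    using assms by (simp add: tclass_def tangle_eq.refl)
  ultimately show "tangle_eq n t u"
    by (simp add: tclass_def tangle_eq.sym)
next
  assume "tangle_eq n t u"
  then show "tclass n t = tclass n u"
    unfolding tclass_def by (blast intro: tangle_eq.sym tangle_eq.trans)
qed

lemma tclass_eqI: "tangle_eq n t u \<Longrightarrow> tclass n t = tclass n u"
  using tclass_eq_iff tangle_eq_wf by blast

lemma tangle_eq_trep: "wf_term n t \<Longrightarrow> tangle_eq n t (trep (tclass n t))"
proof -
  assume "wf_term n t"
  then have "t \<in> tclass n t"
    by (simp add: tclass_def tangle_eq.refl)
  then have "trep (tclass n t) \<in> tclass n t"
    unfolding trep_def by (rule someI)
  then show ?thesis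
    by (simp add: tclass_def)
qed

lemma wf_trep:
  assumes "wf_term n t"
  shows "wf_term n (trep (tclass n t))"
    and "tdom n (trep (tclass n t)) = tdom n t"
    and "tcod n (trep (tclass n t)) = tcod n t"
  using tangle_eq_wf[OF tangle_eq_trep[OF assms]] by auto

lemma Tangle_simps [simp]:
  "Obj (Tangle n) = UNIV"
  "Ident (Tangle n) a = tclass n (TId a)"
  "Unit (Tangle n) = 0"
  "TensObj (Tangle n) a b = a + b"
  "Twist (Tangle n) a b = tclass n (TTwist a b)"
  by (simp_all add: Tangle_def)

lemma Tangle_Arr [simp]: "wf_term n t \<Longrightarrow> tclass n t \<in> Arr (Tangle n)"
  by (simp add: Tangle_def)

lemma Tangle_ArrE:
  assumes "X \<in> Arr (Tangle n)"
  obtains t where "wf_term n t" "X = tclass n t"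
  using assms by (auto simp: Tangle_def)

lemma Tangle_Dom [simp]: "wf_term n t \<Longrightarrow> Dom (Tangle n) (tclass n t) = tdom n t"
  by (simp add: Tangle_def wf_trep)

lemma Tangle_Cod [simp]: "wf_term n t \<Longrightarrow> Cod (Tangle n) (tclass n t) = tcod n t"
  by (simp add: Tangle_def wf_trep)

lemma Tangle_Hom: "wf_term n t \<Longrightarrow> tclass n t \<in> Hom (Tangle n) a b \<longleftrightarrow> tdom n t = a \<and> tcod n t = b"
  by (simp add: Hom_def)

lemma Tangle_HomE:
  assumes "X \<in> Hom (Tangle n) a b"
  obtains t where "wf_term n t" "X = tclass n t" "tdom n t = a" "tcod n t = b"
  using assms by (auto simp: Hom_def elim!: Tangle_ArrE)

lemma Tangle_Cmp [simp]:
  assumes "wf_term n f" "wf_term n g" "tdom n g = tcod n f"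
  shows "tclass n g \<cdot>\<^bsub>Tangle n\<^esub> tclass n f = tclass n (TCmp g f)"
proof -
  have "tangle_eq n (TCmp g f) (TCmp (trep (tclass n g)) (trep (tclass n f)))"
    using assms by (intro tangle_eq.Cmp_cong tangle_eq_trep)
  then show ?thesis
    by (simp add: Tangle_def tclass_eqI)
qed

lemma Tangle_TensArr [simp]:
  assumes "wf_term n f" "wf_term n g"
  shows "tclass n f \<boxtimes>\<^bsub>Tangle n\<^esub> tclass n g = tclass n (TTens f g)"
proof -
  have "tangle_eq n (TTens f g) (TTens (trep (tclass n f)) (trep (tclass n g)))"
    using assms by (intro tangle_eq.Tens_cong tangle_eq_trep)
  then show ?thesis
    by (simp add: Tangle_def tclass_eqI)
qed

lemma Tangle_tensor_power [simp]:
  "tensor_power (Tangle n) Tangle_A k = k" "tensor_power (Tangle n) (Suc 0) k = k"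
  by (induction k) simp_all

lemma Tangle_inverse_Twist:
  "inverse_arrows (Tangle n) (tclass n (TTwist a b)) (tclass n (TTwistInv a b))"
  by (simp add: inverse_arrows_def Tangle_Hom add.commute
      tclass_eqI[OF tangle_eq.Twist_inv_left] tclass_eqI[OF tangle_eq.Twist_inv_right])

lemma Tangle_braided: "braided_strict_monoidal_category (Tangle n)"
proof (unfold_locales, goal_cases)
  case (3 a) then show ?case by (simp add: Tangle_Hom)
next
  case (4 f a b g c) then show ?case by (auto elim!: Tangle_HomE simp: Tangle_Hom)
next
  case (5 f a b) then show ?case by (elim Tangle_HomE) (clarsimp simp: tclass_eqI[OF tangle_eq.Id_left])
next
  case (6 f a b) then show ?case by (elim Tangle_HomE) (clarsimp simp: tclass_eqI[OF tangle_eq.Id_right])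
next
  case (7 f a b g c h d)
  then show ?case by (elim Tangle_HomE) (clarsimp simp: tclass_eqI[OF tangle_eq.Cmp_assoc])
next
  case (10 f a b g c d) then show ?case by (auto elim!: Tangle_HomE simp: Tangle_Hom)
next
  case (11 a b) then show ?case by (simp add: tclass_eqI[OF tangle_eq.Tens_Id])
next
  case (12 f a b g c f' a' b' g' c')
  then show ?case by (elim Tangle_HomE) (clarsimp simp: tclass_eqI[OF tangle_eq.Tens_Cmp])
next
  case (16 f g h) then show ?case by (elim Tangle_ArrE) (clarsimp simp: tclass_eqI[OF tangle_eq.Tens_assoc])
next
  case (17 f) then show ?case by (elim Tangle_ArrE) (clarsimp simp: tclass_eqI[OF tangle_eq.Tens_unit_left])
next
  case (18 f) then show ?case by (elim Tangle_ArrE) (clarsimp simp: tclass_eqI[OF tangle_eq.Tens_unit_right])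
next
  case (19 a b) then show ?case by (simp add: Tangle_Hom)
next
  case (20 a b) then show ?case using Tangle_inverse_Twist by auto
next
  case (21 f a a' g b b')
  then show ?case by (elim Tangle_HomE) (clarsimp simp: tclass_eqI[OF tangle_eq.Twist_natural])
next
  case (22 a b c) then show ?case by (simp add: tclass_eqI[OF tangle_eq.Twist_tensor_right])
next
  case (23 a b c) then show ?case by (simp add: add_ac tclass_eqI[OF tangle_eq.Twist_tensor_left])
qed simp_all

lemma Tangle_blocked_tangle_algebra:
  "blocked_tangle_algebra (Tangle n) Tangle_A (Tangle_eta n) (Tangle_eps n) n (Tangle_R n) (Tangle_S n)"
proof -
  interpret braided_strict_monoidal_category "Tangle n"
    by (rule Tangle_braided)
  show ?thesis
    by unfold_locales
      (simp_all del: One_nat_def add: Tangle_Hom Tangle_eta_def Tangle_eps_def Tangle_R_def Tangle_S_def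
        tclass_eqI[OF tangle_eq.Zigzag_left] tclass_eqI[OF tangle_eq.Zigzag_right]
        tclass_eqI[OF tangle_eq.Eps_Twist] tclass_eqI[OF tangle_eq.Twist_Eta])
qed

context blocked_tangle_algebra
begin

fun eval_term :: "tangle_term \<Rightarrow> 'm" where
  "eval_term (TId a) = Ident C (tensor_power C A a)"
| "eval_term (TCmp g f) = eval_term g \<cdot> eval_term f"
| "eval_term (TTens f g) = eval_term f \<boxtimes> eval_term g"
| "eval_term (TTwist a b) = Twist C (tensor_power C A a) (tensor_power C A b)"
| "eval_term (TTwistInv a b) =
     (THE g. inverse_arrows C (Twist C (tensor_power C A a) (tensor_power C A b)) g)"
| "eval_term TEta = \<eta>"
| "eval_term TEps = \<epsilon>"
| "eval_term TR = R"
| "eval_term TS = S"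

lemma power_Obj [simp]: "tensor_power C A k \<in> Obj C"
  by (rule tensor_power_Obj[OF A_Obj])

lemma power_add: "tensor_power C A (j + k) = tensor_power C A j \<star> tensor_power C A k"
  by (rule tensor_power_add[OF A_Obj])

lemma power_1: "tensor_power C A (Suc 0) = A"
  by (simp add: TensObj_Unit_right A_Obj)

lemma power_2: "tensor_power C A 2 = A \<star> A"
  by (simp add: numeral_2_eq_2 TensObj_Unit_right A_Obj)

lemma eval_TTwistInv:
  "inverse_arrows C (Twist C (tensor_power C A a) (tensor_power C A b)) (eval_term (TTwistInv a b))"
proof -
  obtain g where g: "inverse_arrows C (Twist C (tensor_power C A a) (tensor_power C A b)) g"
    using Twist_iso[of "tensor_power C A a" "tensor_power C A b"] by auto
  then have "eval_term (TTwistInv a b) = g"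
    using inverse_arrows_unique by auto
  with g show ?thesis by simp
qed

lemma eval_Hom:
  "wf_term n t \<Longrightarrow> eval_term t \<in> Hom C (tensor_power C A (tdom n t)) (tensor_power C A (tcod n t))"
proof (induction t)
  case (TCmp g f)
  then have "eval_term f \<in> Hom C (tensor_power C A (tdom n f)) (tensor_power C A (tcod n f))"
    "eval_term g \<in> Hom C (tensor_power C A (tcod n f)) (tensor_power C A (tcod n g))"
    by simp_all
  from Cmp_Hom[OF this] show ?case by simp
next
  case (TTens f g)
  then have "eval_term f \<in> Hom C (tensor_power C A (tdom n f)) (tensor_power C A (tcod n f))"
    "eval_term g \<in> Hom C (tensor_power C A (tdom n g)) (tensor_power C A (tcod n g))"
    by simp_all
  from TensArr_Hom[OF this] show ?case by (simp add: power_add)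
next
  case (TTwistInv a b)
  have "eval_term (TTwistInv a b) \<in> Hom C (tensor_power C A b \<star> tensor_power C A a)
      (tensor_power C A a \<star> tensor_power C A b)"
    using eval_TTwistInv[of a b] HomD(2,3)[OF Twist_Hom[OF power_Obj power_Obj, of a b]]
    unfolding inverse_arrows_def by metis
  then show ?case
    by (simp only: tdom.simps tcod.simps power_add)
next
  case (TId a)
  show ?case by (simp add: Ident_Hom)
next
  case (TTwist a b)
  show ?case using Twist_Hom[OF power_Obj power_Obj, of a b] by (simp add: power_add)
next
  case TEta
  show ?case using eta_Hom by (simp add: power_2)
next
  case TEps
  show ?case using eps_Hom by (simp add: power_2)
next
  case TR
  show ?case using R_Hom by simp
next
  case TS
  show ?case using S_Hom by simp
qed

lemma eval_Arr: "wf_term n t \<Longrightarrow> eval_term t \<in> Arr C"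
  by (rule HomD(1)[OF eval_Hom])

lemma eval_eq: "tangle_eq n t u \<Longrightarrow> eval_term t = eval_term u"
proof (induction rule: tangle_eq.induct)
  case (refl t)
  show ?case by (rule HOL.refl)
next
  case (sym t u)
  show ?case by (rule sym.IH[symmetric])
next
  case (trans t u v)
  show ?case using trans.IH by (rule HOL.trans)
next
  case (Cmp_cong g g' f f')
  show ?case by (simp only: eval_term.simps Cmp_cong.IH)
next
  case (Tens_cong f f' g g')
  show ?case by (simp only: eval_term.simps Tens_cong.IH)
next
  case (Id_left f)
  then show ?case using Cmp_Ident_left[OF eval_Hom] by simp
next
  case (Id_right f)
  then show ?case using Cmp_Ident_right[OF eval_Hom] by simp
next
  case (Cmp_assoc f g h)
  then have "eval_term f \<in> Hom C (tensor_power C A (tdom n f)) (tensor_power C A (tcod n f))"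
    "eval_term g \<in> Hom C (tensor_power C A (tcod n f)) (tensor_power C A (tcod n g))"
    "eval_term h \<in> Hom C (tensor_power C A (tcod n g)) (tensor_power C A (tcod n h))"
    using eval_Hom[of f] eval_Hom[of g] eval_Hom[of h] by simp_all
  then show ?case
    using braided_strict_monoidal_category.Cmp_assoc[OF braided_strict_monoidal_category_axioms]
    by (simp del: eval_term.simps add: eval_term.simps(2))
next
  case (Tens_Cmp f g f' g')
  then have "eval_term f \<in> Hom C (tensor_power C A (tdom n f)) (tensor_power C A (tcod n f))"
    "eval_term g \<in> Hom C (tensor_power C A (tcod n f)) (tensor_power C A (tcod n g))"
    "eval_term f' \<in> Hom C (tensor_power C A (tdom n f')) (tensor_power C A (tcod n f'))"
    "eval_term g' \<in> Hom C (tensor_power C A (tcod n f')) (tensor_power C A (tcod n g'))"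
    using eval_Hom[of f] eval_Hom[of g] eval_Hom[of f'] eval_Hom[of g'] by simp_all
  from TensArr_Cmp[OF this] show ?case by simp
next
  case (Tens_unit_left f)
  then show ?case using TensArr_Unit_left[OF eval_Arr] by simp
next
  case (Tens_unit_right f)
  then show ?case using TensArr_Unit_right[OF eval_Arr] by simp
next
  case (Twist_inv_left a b)
  show ?case
    using eval_TTwistInv[of a b] HomD[OF Twist_Hom[OF power_Obj power_Obj, of a b]]
    by (auto simp: inverse_arrows_def power_add simp del: eval_term.simps(5))
next
  case (Twist_inv_right a b)
  show ?case
    using eval_TTwistInv[of a b] HomD[OF Twist_Hom[OF power_Obj power_Obj, of a b]]
    by (auto simp: inverse_arrows_def power_add simp del: eval_term.simps(5))
next
  case (Twist_natural f g)
  then show ?case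
    using braided_strict_monoidal_category.Twist_natural[OF braided_strict_monoidal_category_axioms
        eval_Hom eval_Hom] by simp
next
  case (Twist_tensor_right a b c)
  show ?case
    using braided_strict_monoidal_category.Twist_tensor_right[OF braided_strict_monoidal_category_axioms]
    by (simp add: power_add)
next
  case (Twist_tensor_left a b c)
  show ?case
    using braided_strict_monoidal_category.Twist_tensor_left[OF braided_strict_monoidal_category_axioms]
    by (simp add: power_add)
next
  case (Tens_Id a b)
  show ?case by (simp add: TensArr_Ident power_add)
next
  case (Tens_assoc f g h)
  then show ?case using TensArr_assoc[OF eval_Arr eval_Arr eval_Arr] by simp
next
  case Zigzag_left
  show ?case using zigzag_left by (simp del: tensor_power.simps add: power_1)
next
  case Zigzag_right
  show ?case using zigzag_right by (simp del: tensor_power.simps add: power_1)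
next
  case Eps_Twist
  show ?case using eps_Twist by (simp del: tensor_power.simps add: power_1)
next
  case Twist_Eta
  show ?case using Twist_eta by (simp del: tensor_power.simps add: power_1)
qed

lemma eval_trep: "wf_term n t \<Longrightarrow> eval_term (trep (tclass n t)) = eval_term t"
  using eval_eq[OF tangle_eq_trep] by simp

theorem Tangle_universal:
  obtains Fo Fa where
    "strict_braided_functor (Tangle n) C Fo Fa"
    "Fo Tangle_A = A" "Fa (Tangle_eta n) = \<eta>" "Fa (Tangle_eps n) = \<epsilon>"
    "Fa (Tangle_R n) = R" "Fa (Tangle_S n) = S"
proof -
  interpret T: braided_strict_monoidal_category "Tangle n"
    by (rule Tangle_braided)
  have "strict_braided_functor (Tangle n) C (tensor_power C A) (\<lambda>X. eval_term (trep X))"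
  proof (unfold_locales, goal_cases)
    case (2 f a b)
    then show ?case by (auto elim!: Tangle_HomE simp: eval_trep eval_Hom)
  next
    case (4 f a b g c)
    then show ?case by (auto elim!: Tangle_HomE simp: eval_trep)
  next
    case (7 f g)
    then show ?case by (auto elim!: Tangle_ArrE simp: eval_trep)
  qed (simp_all add: eval_trep power_add)
  then show thesis
    by (rule that)
      (simp_all add: TensObj_Unit_right A_Obj Tangle_eta_def Tangle_eps_def Tangle_R_def Tangle_S_def eval_trep)
qed

end

theorem Tangle_functor_unique:
  assumes F: "strict_braided_functor (Tangle n) D Fo Fa"
    and G: "strict_braided_functor (Tangle n) D Go Ga"
    and eq: "Fo Tangle_A = Go Tangle_A" "Fa (Tangle_eta n) = Ga (Tangle_eta n)"
      "Fa (Tangle_eps n) = Ga (Tangle_eps n)" "Fa (Tangle_R n) = Ga (Tangle_R n)"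
      "Fa (Tangle_S n) = Ga (Tangle_S n)"
  shows "\<And>a. a \<in> Obj (Tangle n) \<Longrightarrow> Fo a = Go a"
    and "\<And>f. f \<in> Arr (Tangle n) \<Longrightarrow> Fa f = Ga f"
proof -
  interpret F: strict_braided_functor "Tangle n" D Fo Fa by (rule F)
  interpret G: strict_braided_functor "Tangle n" D Go Ga by (rule G)
  have ob: "Fo a = Go a" for a
  proof (induction a)
    case 0
    then show ?case using F.F_Unit G.F_Unit by simp
  next
    case (Suc a)
    then show ?case using F.F_TensObj[of 1 a] G.F_TensObj[of 1 a] eq(1) by simp
  qed
  have ar: "Fa (tclass n t) = Ga (tclass n t)" if "wf_term n t" for t
    using that
  proof (induction t)
    case (TId a)
    then show ?case using F.F_Ident[of a] G.F_Ident[of a] ob by simp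
  next
    case (TCmp g f)
    then have h: "tclass n f \<in> Hom (Tangle n) (tdom n f) (tcod n f)"
      "tclass n g \<in> Hom (Tangle n) (tcod n f) (tcod n g)"
      by (simp_all add: Tangle_Hom)
    show ?case using TCmp F.F_Cmp[OF h] G.F_Cmp[OF h] by simp
  next
    case (TTens f g)
    then show ?case
      using F.F_TensArr[of "tclass n f" "tclass n g"] G.F_TensArr[of "tclass n f" "tclass n g"] by simp
  next
    case (TTwist a b)
    then show ?case using F.F_Twist[of a b] G.F_Twist[of a b] ob by simp
  next
    case (TTwistInv a b)
    have "Fa (tclass n (TTwist a b)) = Ga (tclass n (TTwist a b))"
      using F.F_Twist[of a b] G.F_Twist[of a b] ob by simp
    then show ?case
      using F.F_inverse_arrows[OF Tangle_inverse_Twist, of a b]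
        G.F_inverse_arrows[OF Tangle_inverse_Twist, of a b] F.target.inverse_arrows_unique by metis
  qed (use eq in \<open>simp_all add: Tangle_eta_def Tangle_eps_def Tangle_R_def Tangle_S_def\<close>)
  show "\<And>a. a \<in> Obj (Tangle n) \<Longrightarrow> Fo a = Go a" by (rule ob)
  show "\<And>f. f \<in> Arr (Tangle n) \<Longrightarrow> Fa f = Ga f" by (auto elim!: Tangle_ArrE simp: ar)
qed

section \<open>Braids and the blocked-braid group\<close>

inductive_set braid_layers :: "('o, 'm, 'x) monoidal_data_scheme \<Rightarrow> 'o \<Rightarrow> 'm set"
  for C :: "('o, 'm, 'x) monoidal_data_scheme" and A :: 'o where
  layer_Ident: "Ident C (tensor_power C A k) \<in> braid_layers C A"
| layer_Twist: "Twist C A A \<in> braid_layers C A"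
| layer_Twist_inv: "inverse_arrows C (Twist C A A) g \<Longrightarrow> g \<in> braid_layers C A"
| layer_TensArr: "f \<in> braid_layers C A \<Longrightarrow> g \<in> braid_layers C A \<Longrightarrow> f \<boxtimes>\<^bsub>C\<^esub> g \<in> braid_layers C A"

inductive_set braids :: "('o, 'm, 'x) monoidal_data_scheme \<Rightarrow> 'o \<Rightarrow> nat \<Rightarrow> 'm set"
  for C :: "('o, 'm, 'x) monoidal_data_scheme" and A :: 'o and k :: nat where
  braid_layer: "f \<in> braid_layers C A \<Longrightarrow>
    f \<in> Hom C (tensor_power C A k) (tensor_power C A k) \<Longrightarrow> f \<in> braids C A k"
| braid_Cmp: "f \<in> braids C A k \<Longrightarrow> g \<in> braids C A k \<Longrightarrow> g \<cdot>\<^bsub>C\<^esub> f \<in> braids C A k"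

abbreviation Tangle_braids :: "nat \<Rightarrow> tangle_term set set" where
  "Tangle_braids n \<equiv> braids (Tangle n) Tangle_A n"

definition blocked :: "nat \<Rightarrow> tangle_term set \<Rightarrow> tangle_term set" where
  "blocked n B = Tangle_S n \<cdot>\<^bsub>Tangle n\<^esub> B \<cdot>\<^bsub>Tangle n\<^esub> Tangle_R n"

text \<open>
  The product does not depend on the choice of the braids (lemma \<open>BB_mult\<close>), so the
  definite description denotes.
\<close>

definition BB :: "nat \<Rightarrow> tangle_term set monoid" where
  "BB n = \<lparr>
     carrier = blocked n ` Tangle_braids n,
     monoid.mult = (\<lambda>x y. THE z. \<exists>B \<in> Tangle_braids n. \<exists>B' \<in> Tangle_braids n.
        x = blocked n B \<and> y = blocked n B' \<and> z = blocked n (B \<cdot>\<^bsub>Tangle n\<^esub> B')),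
     one = blocked n (Ident (Tangle n) n) \<rparr>"

context tangle_algebra
begin

lemma braids_Hom: "f \<in> braids C A k \<Longrightarrow> f \<in> Hom C (tensor_power C A k) (tensor_power C A k)"
  by (induction rule: braids.induct) (assumption, rule Cmp_Hom)

lemma layer_inverse: "f \<in> braid_layers C A \<Longrightarrow> \<exists>g \<in> braid_layers C A. inverse_arrows C f g"
proof (induction rule: braid_layers.induct)
  case (layer_Ident k)
  show ?case
    by (intro bexI[of _ "Ident C (tensor_power C A k)"] inverse_arrows_Ident tensor_power_Obj A_Obj
        braid_layers.layer_Ident)
next
  case layer_Twist
  obtain g where "inverse_arrows C (Twist C A A) g"
    using Twist_iso[OF A_Obj A_Obj] by (rule exE)
  then show ?case
    by (intro bexI[of _ g] braid_layers.layer_Twist_inv)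
next
  case (layer_Twist_inv g)
  show ?case
    using inverse_arrows_sym[OF layer_Twist_inv] braid_layers.layer_Twist by (rule bexI)
next
  case (layer_TensArr f g)
  obtain f' where f': "f' \<in> braid_layers C A" "inverse_arrows C f f'"
    using layer_TensArr.IH(1) by (rule bexE)
  obtain g' where g': "g' \<in> braid_layers C A" "inverse_arrows C g g'"
    using layer_TensArr.IH(2) by (rule bexE)
  show ?case
    using inverse_arrows_TensArr[OF f'(2) g'(2)] braid_layers.layer_TensArr[OF f'(1) g'(1)]
    by (rule bexI)
qed

lemma braid_inverse: "f \<in> braids C A k \<Longrightarrow> \<exists>g \<in> braids C A k. inverse_arrows C f g"
proof (induction rule: braids.induct)
  case (braid_layer f)
  obtain g where g: "g \<in> braid_layers C A" "inverse_arrows C f g"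
    using layer_inverse[OF braid_layer(1)] by (rule bexE)
  have "g \<in> Hom C (tensor_power C A k) (tensor_power C A k)"
    using g(2) HomD(2,3)[OF braid_layer(2)] by (simp add: inverse_arrows_def)
  with g show ?case
    by (intro bexI[of _ g] braids.braid_layer)
next
  case (braid_Cmp f g)
  obtain f' where f': "f' \<in> braids C A k" "inverse_arrows C f f'"
    using braid_Cmp.IH(1) by (rule bexE)
  obtain g' where g': "g' \<in> braids C A k" "inverse_arrows C g g'"
    using braid_Cmp.IH(2) by (rule bexE)
  have "Dom C g = Cod C f"
    using HomD(3)[OF braids_Hom[OF braid_Cmp.hyps(1)]] HomD(2)[OF braids_Hom[OF braid_Cmp.hyps(2)]] by simp
  with inverse_arrows_Cmp[OF f'(2) g'(2)] braids.braid_Cmp[OF g'(1) f'(1)] show ?case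
    by (intro bexI)
qed

lemma braid_Ident: "Ident C (tensor_power C A k) \<in> braids C A k"
  by (intro braids.braid_layer braid_layers.layer_Ident Ident_Hom tensor_power_Obj A_Obj)

end

lemma Tangle_functor_braid:
  assumes F: "strict_braided_functor (Tangle n) (Tangle n) Fo Fa" and A: "Fo Tangle_A = Tangle_A"
    and B: "B \<in> Tangle_braids n"
  shows "Fa B = B"
proof -
  interpret F: strict_braided_functor "Tangle n" "Tangle n" Fo Fa by (rule F)
  interpret T: blocked_tangle_algebra "Tangle n" Tangle_A "Tangle_eta n" "Tangle_eps n" n "Tangle_R n" "Tangle_S n"
    by (rule Tangle_blocked_tangle_algebra)
  have ob: "Fo a = a" for a
  proof (induction a)
    case 0
    then show ?case using F.F_Unit by simp
  next
    case (Suc a)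
    then show ?case using F.F_TensObj[of 1 a] A by simp
  qed
  have tw: "Fa (Twist (Tangle n) a b) = Twist (Tangle n) a b" for a b
    using F.F_Twist[of a b] ob by simp
  have layer: "f \<in> Arr (Tangle n) \<and> Fa f = f" if "f \<in> braid_layers (Tangle n) Tangle_A" for f
    using that
  proof (induction rule: braid_layers.induct)
    case (layer_Ident k)
    then show ?case using F.F_Ident[of k] ob by simp
  next
    case layer_Twist
    then show ?case using tw by simp
  next
    case (layer_Twist_inv g)
    have "inverse_arrows (Tangle n) (Twist (Tangle n) Tangle_A Tangle_A) (Fa g)"
      using F.F_inverse_arrows[OF layer_Twist_inv] unfolding tw .
    then have "Fa g = g"
      using layer_Twist_inv by (rule F.source.inverse_arrows_unique)
    moreover have "g \<in> Arr (Tangle n)"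
      using layer_Twist_inv by (simp add: inverse_arrows_def Hom_def)
    ultimately show ?case by simp
  next
    case (layer_TensArr f g)
    then show ?case
      using F.F_TensArr[of f g] HomD(1)[OF F.source.TensArr_Hom[OF Arr_Hom[of f] Arr_Hom[of g]]] by simp
  qed
  show ?thesis
    using B
  proof (induction rule: braids.induct)
    case (braid_layer f)
    then show ?case using layer by blast
  next
    case (braid_Cmp f g)
    then show ?case using F.F_Cmp[OF T.braids_Hom T.braids_Hom] by simp
  qed
qed

lemma
  assumes B: "B1 \<in> Tangle_braids n" "B2 \<in> Tangle_braids n" and D: "D \<in> Tangle_braids n"
    and eq: "blocked n B1 = blocked n B2"
  shows blocked_cong_right: "blocked n (B1 \<cdot>\<^bsub>Tangle n\<^esub> D) = blocked n (B2 \<cdot>\<^bsub>Tangle n\<^esub> D)"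
    and blocked_cong_left: "blocked n (D \<cdot>\<^bsub>Tangle n\<^esub> B1) = blocked n (D \<cdot>\<^bsub>Tangle n\<^esub> B2)"
proof -
  let ?T = "Tangle n"
  interpret T: blocked_tangle_algebra ?T Tangle_A "Tangle_eta n" "Tangle_eps n" n "Tangle_R n" "Tangle_S n"
    by (rule Tangle_blocked_tangle_algebra)
  have R: "Tangle_R n \<in> Hom ?T 0 n" and S: "Tangle_S n \<in> Hom ?T n 0"
    using T.R_Hom T.S_Hom by simp_all
  have h: "X \<in> Hom ?T n n" if "X \<in> Tangle_braids n" for X
    using T.braids_Hom[OF that] by simp
  note BR = T.Cmp_Hom[OF R h]
  have val: "Fa (blocked n B) = Fa (Tangle_S n) \<cdot>\<^bsub>?T\<^esub> B \<cdot>\<^bsub>?T\<^esub> Fa (Tangle_R n)"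
    if "strict_braided_functor ?T ?T Fo Fa" "Fo Tangle_A = Tangle_A" "B \<in> Tangle_braids n" for Fo Fa B
  proof -
    interpret F: strict_braided_functor ?T ?T Fo Fa by (rule that(1))
    show ?thesis
      unfolding blocked_def
      using F.F_Cmp[OF BR[OF that(3)] S] F.F_Cmp[OF R h[OF that(3)]] Tangle_functor_braid[OF that] by simp
  qed
  interpret D1: blocked_tangle_algebra ?T Tangle_A "Tangle_eta n" "Tangle_eps n" n "D \<cdot>\<^bsub>?T\<^esub> Tangle_R n" "Tangle_S n"
    using BR[OF D] S by unfold_locales simp_all
  obtain Fo Fa where F: "strict_braided_functor ?T ?T Fo Fa" "Fo Tangle_A = Tangle_A"
    and F': "Fa (Tangle_R n) = D \<cdot>\<^bsub>?T\<^esub> Tangle_R n" "Fa (Tangle_S n) = Tangle_S n"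
    by (rule D1.Tangle_universal) blast
  have twist_R: "Fa (blocked n B) = blocked n (B \<cdot>\<^bsub>?T\<^esub> D)" if "B \<in> Tangle_braids n" for B
    unfolding val[OF F that] F' unfolding blocked_def
    using T.Cmp_assoc[OF R h[OF D] h[OF that]] by simp
  then show "blocked n (B1 \<cdot>\<^bsub>?T\<^esub> D) = blocked n (B2 \<cdot>\<^bsub>?T\<^esub> D)"
    using twist_R[OF B(1)] twist_R[OF B(2)] eq by simp
  interpret D2: blocked_tangle_algebra ?T Tangle_A "Tangle_eta n" "Tangle_eps n" n "Tangle_R n" "Tangle_S n \<cdot>\<^bsub>?T\<^esub> D"
    using R T.Cmp_Hom[OF h[OF D] S] by unfold_locales simp_all
  obtain Go Ga where G: "strict_braided_functor ?T ?T Go Ga" "Go Tangle_A = Tangle_A"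
    and G': "Ga (Tangle_R n) = Tangle_R n" "Ga (Tangle_S n) = Tangle_S n \<cdot>\<^bsub>?T\<^esub> D"
    by (rule D2.Tangle_universal) blast
  have twist_S: "Ga (blocked n B) = blocked n (D \<cdot>\<^bsub>?T\<^esub> B)" if "B \<in> Tangle_braids n" for B
    unfolding val[OF G that] G' unfolding blocked_def
    using T.Cmp_assoc[OF R h[OF that] h[OF D]] T.Cmp_assoc[OF BR[OF that] h[OF D] S] by simp
  then show "blocked n (D \<cdot>\<^bsub>?T\<^esub> B1) = blocked n (D \<cdot>\<^bsub>?T\<^esub> B2)"
    using twist_S[OF B(1)] twist_S[OF B(2)] eq by simp
qed

lemma BB_mult:
  assumes "B \<in> Tangle_braids n" "B' \<in> Tangle_braids n"
  shows "blocked n B \<otimes>\<^bsub>BB n\<^esub> blocked n B' = blocked n (B \<cdot>\<^bsub>Tangle n\<^esub> B')"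
proof -
  have indep: "blocked n (B \<cdot>\<^bsub>Tangle n\<^esub> B') = blocked n (D \<cdot>\<^bsub>Tangle n\<^esub> D')"
    if "D \<in> Tangle_braids n" "D' \<in> Tangle_braids n" "blocked n B = blocked n D" "blocked n B' = blocked n D'"
    for D D'
    using blocked_cong_right[OF assms(1) that(1) assms(2) that(3)]
      blocked_cong_left[OF assms(2) that(2) that(1) that(4)] by (rule HOL.trans)
  show ?thesis
    unfolding BB_def monoid.simps
  proof (rule the_equality)
    show "\<exists>D \<in> Tangle_braids n. \<exists>D' \<in> Tangle_braids n. blocked n B = blocked n D \<and> blocked n B' = blocked n D' \<and>
        blocked n (B \<cdot>\<^bsub>Tangle n\<^esub> B') = blocked n (D \<cdot>\<^bsub>Tangle n\<^esub> D')"
      using assms by (intro bexI[of _ B] bexI[of _ B'] conjI HOL.refl)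
  next
    fix z
    assume "\<exists>D \<in> Tangle_braids n. \<exists>D' \<in> Tangle_braids n. blocked n B = blocked n D \<and> blocked n B' = blocked n D' \<and>
        z = blocked n (D \<cdot>\<^bsub>Tangle n\<^esub> D')"
    then show "z = blocked n (B \<cdot>\<^bsub>Tangle n\<^esub> B')"
      by (elim bexE conjE) (simp only: indep)
  qed
qed

lemma BB_carrier: "carrier (BB n) = blocked n ` Tangle_braids n"
  and BB_one: "\<one>\<^bsub>BB n\<^esub> = blocked n (Ident (Tangle n) n)"
  by (simp_all add: BB_def)

lemma BB_group: "group (BB n)"
proof -
  let ?T = "Tangle n"
  interpret T: blocked_tangle_algebra ?T Tangle_A "Tangle_eta n" "Tangle_eps n" n "Tangle_R n" "Tangle_S n"
    by (rule Tangle_blocked_tangle_algebra)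
  have h: "X \<in> Hom ?T n n" if "X \<in> Tangle_braids n" for X
    using T.braids_Hom[OF that] by simp
  have i: "Ident ?T n \<in> Tangle_braids n"
    using T.braid_Ident[of n] by (simp only: Tangle_tensor_power)
  show ?thesis
  proof (rule groupI)
    fix x y assume "x \<in> carrier (BB n)" "y \<in> carrier (BB n)"
    then show "x \<otimes>\<^bsub>BB n\<^esub> y \<in> carrier (BB n)"
      by (auto simp: BB_carrier BB_mult intro: braids.braid_Cmp)
  next
    show "\<one>\<^bsub>BB n\<^esub> \<in> carrier (BB n)"
      using i by (simp add: BB_carrier BB_one)
  next
    fix x y z assume "x \<in> carrier (BB n)" "y \<in> carrier (BB n)" "z \<in> carrier (BB n)"
    then show "x \<otimes>\<^bsub>BB n\<^esub> y \<otimes>\<^bsub>BB n\<^esub> z = x \<otimes>\<^bsub>BB n\<^esub> (y \<otimes>\<^bsub>BB n\<^esub> z)"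
      by (auto simp: BB_carrier BB_mult braids.braid_Cmp T.Cmp_assoc[OF h h h])
  next
    fix x assume "x \<in> carrier (BB n)"
    then obtain B where B: "B \<in> Tangle_braids n" "x = blocked n B"
      by (auto simp: BB_carrier)
    show "\<one>\<^bsub>BB n\<^esub> \<otimes>\<^bsub>BB n\<^esub> x = x"
      unfolding B BB_one using BB_mult[OF i B(1)] T.Cmp_Ident_left[OF h[OF B(1)]] by simp
    obtain B' where B': "B' \<in> Tangle_braids n" "inverse_arrows ?T B B'"
      using T.braid_inverse[OF B(1)] by blast
    have "B' \<cdot>\<^bsub>?T\<^esub> B = Ident ?T n"
      using B'(2) HomD(2)[OF h[OF B(1)]] unfolding inverse_arrows_def by simp
    then have "blocked n B' \<otimes>\<^bsub>BB n\<^esub> x = \<one>\<^bsub>BB n\<^esub>"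
      unfolding B BB_one using BB_mult[OF B'(1) B(1)] by simp
    then show "\<exists>y \<in> carrier (BB n). y \<otimes>\<^bsub>BB n\<^esub> x = \<one>\<^bsub>BB n\<^esub>"
      using B'(1) by (auto simp: BB_carrier)
  qed
qed

lemma BB_inv:
  assumes "B \<in> Tangle_braids n" "B' \<in> Tangle_braids n" "inverse_arrows (Tangle n) B B'"
  shows "inv\<^bsub>BB n\<^esub> (blocked n B) = blocked n B'"
proof -
  let ?T = "Tangle n"
  interpret T: blocked_tangle_algebra ?T Tangle_A "Tangle_eta n" "Tangle_eps n" n "Tangle_R n" "Tangle_S n"
    by (rule Tangle_blocked_tangle_algebra)
  have "B' \<cdot>\<^bsub>?T\<^esub> B = Ident ?T n"
    using assms(3) HomD(2)[OF T.braids_Hom[OF assms(1)]] unfolding inverse_arrows_def by simp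
  then have "blocked n B' \<otimes>\<^bsub>BB n\<^esub> blocked n B = \<one>\<^bsub>BB n\<^esub>"
    using BB_mult[OF assms(2,1)] by (simp add: BB_one)
  then show ?thesis
    using assms by (intro group.inv_equality[OF BB_group]) (auto simp: BB_carrier)
qed

end

theory Submission
  imports Defs
begin

text \<open>
  Write \<open>\<tau>\<close> for the twist of two copies of \<open>A\<close>. A braid on two strings acts on \<open>R\<close> through
  the powers of \<open>\<tau>\<close>, so it is enough to show \<open>\<tau>\<tau>R = R\<close> and \<open>S\<tau>R \<noteq> SR\<close>.

  The equation holds for every arrow \<open>R : I \<rightarrow> A \<otimes> A\<close> of every tangle algebra. Geometrically,
  the full twist makes the first string of \<open>R\<close> encircle the second one; since \<open>R\<close> has no other
  strings, this loop can be pulled over the box \<open>R\<close>, where it becomes a loop of the first string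
  around itself, which the equation \<open>\<epsilon>\<tau> = \<epsilon>\<close> removes. In algebraic terms, bend the first string
  of \<open>R\<close> into the arrow \<open>(\<epsilon> \<otimes> 1)(1 \<otimes> R) : A \<rightarrow> A\<close>, which determines \<open>R\<close> (\<open>bend_inject\<close>). A
  string that goes once around both strings of \<open>R\<close> may be removed by naturality
  (\<open>encircle\<close>), and when it is first introduced next to \<open>\<tau>\<tau>R\<close>, the Yang-Baxter equation and the
  naturality of the twist with respect to \<open>\<epsilon>\<close> cancel it against \<open>\<tau>\<tau>\<close> (\<open>full_twist\<close>).

  For the inequality, interpret arrows as relations between strings of bits: twists permute blocks
  of bits, and \<open>\<eta>\<close> and \<open>\<epsilon>\<close> relate the empty string to \<open>bb\<close> for either bit \<open>b\<close>.
  Since no equation constrains \<open>R\<close> and \<open>S\<close>, both may single out the string \<open>01\<close>, whose bits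
  differ. Then \<open>SR\<close> is the full relation between empty strings, and \<open>S\<tau>R\<close> is the empty relation.
\<close>

section \<open>The full twist of two strings\<close>

context braided_strict_monoidal_category
begin

text \<open>
  The axioms with domains and codomains in place of homsets, so that the
  simplifier can compute the types of composites.
\<close>

lemma Cmp_typing:
  assumes "f \<in> Arr C" "g \<in> Arr C" "Dom C g = Cod C f"
  shows "g \<cdot> f \<in> Arr C" "Dom C (g \<cdot> f) = Dom C f" "Cod C (g \<cdot> f) = Cod C g"
  using HomD[OF Cmp_Hom[OF HomI[OF assms(1)] HomI[OF assms(2)]]] assms(3) by simp_all

lemma TensArr_typing:
  assumes "f \<in> Arr C" "g \<in> Arr C"
  shows "f \<boxtimes> g \<in> Arr C" "Dom C (f \<boxtimes> g) = Dom C f \<star> Dom C g" "Cod C (f \<boxtimes> g) = Cod C f \<star> Cod C g"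
  using HomD[OF TensArr_Hom[OF Arr_Hom[OF assms(1)] Arr_Hom[OF assms(2)]]] by simp_all

lemma Ident_typing:
  assumes "a \<in> Obj C"
  shows "Ident C a \<in> Arr C" "Dom C (Ident C a) = a" "Cod C (Ident C a) = a"
  using HomD[OF Ident_Hom[OF assms]] by simp_all

lemma Twist_typing:
  assumes "a \<in> Obj C" "b \<in> Obj C"
  shows "Twist C a b \<in> Arr C" "Dom C (Twist C a b) = a \<star> b" "Cod C (Twist C a b) = b \<star> a"
  using HomD[OF Twist_Hom[OF assms]] by simp_all

lemmas typing = Cmp_typing TensArr_typing Ident_typing Twist_typing

lemma Cmp_assoc':
  assumes "f \<in> Arr C" "g \<in> Arr C" "h \<in> Arr C" "Dom C g = Cod C f" "Dom C h = Cod C g"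
  shows "(h \<cdot> g) \<cdot> f = h \<cdot> (g \<cdot> f)"
  using Cmp_assoc[OF HomI[OF assms(1)] HomI[OF assms(2)] HomI[OF assms(3)]] assms(4,5) by simp

lemma Cmp_Ident':
  assumes "f \<in> Arr C"
  shows "Ident C (Cod C f) \<cdot> f = f" "f \<cdot> Ident C (Dom C f) = f"
  using Cmp_Ident_left[OF Arr_Hom[OF assms]] Cmp_Ident_right[OF Arr_Hom[OF assms]] by simp_all

lemma TensArr_Cmp':
  assumes "f \<in> Arr C" "g \<in> Arr C" "f' \<in> Arr C" "g' \<in> Arr C" "Dom C g = Cod C f" "Dom C g' = Cod C f'"
  shows "(g \<cdot> f) \<boxtimes> (g' \<cdot> f') = (g \<boxtimes> g') \<cdot> (f \<boxtimes> f')"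
  using TensArr_Cmp[OF HomI[OF assms(1)] HomI[OF assms(2)] HomI[OF assms(3)] HomI[OF assms(4)]] assms(5,6)
  by simp

lemma Cmp_TensArr_Ident:
  assumes "a \<in> Obj C" "f \<in> Arr C" "g \<in> Arr C" "Dom C g = Cod C f"
  shows "Ident C a \<boxtimes> (g \<cdot> f) = (Ident C a \<boxtimes> g) \<cdot> (Ident C a \<boxtimes> f)"
    and "(g \<cdot> f) \<boxtimes> Ident C a = (g \<boxtimes> Ident C a) \<cdot> (f \<boxtimes> Ident C a)"
  using TensArr_Cmp'[of "Ident C a" "Ident C a" f g] TensArr_Cmp'[of f g "Ident C a" "Ident C a"]
    Cmp_Ident'(1)[of "Ident C a"] assms by (simp_all add: Ident_typing)

lemma Twist_natural':
  assumes "f \<in> Arr C" "g \<in> Arr C"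
  shows "(g \<boxtimes> f) \<cdot> Twist C (Dom C f) (Dom C g) = Twist C (Cod C f) (Cod C g) \<cdot> (f \<boxtimes> g)"
  using Twist_natural[OF Arr_Hom[OF assms(1)] Arr_Hom[OF assms(2)]] .

text \<open>
  Decomposing \<open>I\<close> as \<open>I \<otimes> I\<close> in the axioms for the twist of a tensor product shows that the twist
  with the unit is idempotent, and an idempotent isomorphism is an identity.
\<close>

lemma Twist_Unit:
  assumes a: "a \<in> Obj C"
  shows "Twist C (Unit C) a = Ident C a" "Twist C a (Unit C) = Ident C a"
proof -
  note o = a Unit_Obj TensObj_Unit_left[OF a] TensObj_Unit_right[OF a]
  have idem: "f = Ident C a" if f: "f \<cdot> f = f" and iso: "inverse_arrows C f g"
    and t: "f \<in> Arr C" "Dom C f = a" "Cod C f = a" for f g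
  proof -
    have g: "g \<in> Arr C" "Dom C g = a" "Cod C g = a" "g \<cdot> f = Ident C a"
      using iso t by (auto simp: inverse_arrows_def Hom_def)
    have "Ident C a = g \<cdot> (f \<cdot> f)" using f g by simp
    also have "\<dots> = (g \<cdot> f) \<cdot> f" using Cmp_assoc'[of f f g] t g by simp
    also have "\<dots> = f" using Cmp_Ident'(1)[of f] t g by simp
    finally show ?thesis by simp
  qed
  have U: "Unit C \<star> Unit C = Unit C" by (rule TensObj_Unit_left[OF Unit_Obj])
  show "Twist C (Unit C) a = Ident C a"
  proof -
    obtain g where "inverse_arrows C (Twist C (Unit C) a) g"
      using Twist_iso[OF Unit_Obj a] by blast
    moreover have "Twist C (Unit C) a \<cdot> Twist C (Unit C) a = Twist C (Unit C) a"
      using Twist_tensor_left[OF Unit_Obj Unit_Obj a]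
      by (simp add: o U TensArr_Unit_left TensArr_Unit_right Twist_typing)
    ultimately show ?thesis
      by (intro idem) (simp_all add: Twist_typing o)
  qed
  show "Twist C a (Unit C) = Ident C a"
  proof -
    obtain g where "inverse_arrows C (Twist C a (Unit C)) g"
      using Twist_iso[OF a Unit_Obj] by blast
    moreover have "Twist C a (Unit C) \<cdot> Twist C a (Unit C) = Twist C a (Unit C)"
      using Twist_tensor_right[OF a Unit_Obj Unit_Obj]
      by (simp add: o U TensArr_Unit_left TensArr_Unit_right Twist_typing)
    ultimately show ?thesis
      by (intro idem) (simp_all add: Twist_typing o)
  qed
qed

end

context tangle_algebra
begin

abbreviation (input) "i \<equiv> Ident C A"
abbreviation (input) "t \<equiv> Twist C A A"

lemma eta_typing: "\<eta> \<in> Arr C" "Dom C \<eta> = Unit C" "Cod C \<eta> = A \<star> A"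
  using HomD[OF eta_Hom] by simp_all

lemma eps_typing: "\<epsilon> \<in> Arr C" "Dom C \<epsilon> = A \<star> A" "Cod C \<epsilon> = Unit C"
  using HomD[OF eps_Hom] by simp_all

lemmas tangle_typing = typing eta_typing eps_typing A_Obj Unit_Obj TensObj_Obj TensObj_assoc
  TensObj_Unit_left TensObj_Unit_right

text \<open>This is naturality of the twist of \<open>A \<otimes> A\<close> and \<open>A\<close> with respect to the twist itself.\<close>

lemma Yang_Baxter:
  "(t \<boxtimes> i) \<cdot> (i \<boxtimes> t) \<cdot> (t \<boxtimes> i) = (i \<boxtimes> t) \<cdot> (t \<boxtimes> i) \<cdot> (i \<boxtimes> t)"
  using Twist_natural'[of t i] Twist_tensor_left[OF A_Obj A_Obj A_Obj]
  by (simp add: tangle_typing Cmp_assoc')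

text \<open>
  Naturality of the twist with respect to \<open>\<epsilon>\<close>: a string in front of a cap slides to its other side.
\<close>

lemma slide_cap:
  "(\<epsilon> \<boxtimes> i) \<cdot> (i \<boxtimes> t) \<cdot> (t \<boxtimes> i) = i \<boxtimes> \<epsilon>"
  "(i \<boxtimes> \<epsilon>) \<cdot> (t \<boxtimes> i) \<cdot> (i \<boxtimes> t) = \<epsilon> \<boxtimes> i"
proof -
  show "(\<epsilon> \<boxtimes> i) \<cdot> (i \<boxtimes> t) \<cdot> (t \<boxtimes> i) = i \<boxtimes> \<epsilon>"
    using Twist_natural'[of i \<epsilon>] Twist_tensor_right[OF A_Obj A_Obj A_Obj] Cmp_Ident'(1)[of "i \<boxtimes> \<epsilon>"]
    by (simp add: tangle_typing Twist_Unit)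
  show "(i \<boxtimes> \<epsilon>) \<cdot> (t \<boxtimes> i) \<cdot> (i \<boxtimes> t) = \<epsilon> \<boxtimes> i"
    using Twist_natural'[of \<epsilon> i] Twist_tensor_left[OF A_Obj A_Obj A_Obj] Cmp_Ident'(1)[of "\<epsilon> \<boxtimes> i"]
    by (simp add: tangle_typing Twist_Unit)
qed

lemma cap_absorbs_twist:
  "(\<epsilon> \<boxtimes> i) \<cdot> (t \<boxtimes> i) = \<epsilon> \<boxtimes> i" "(i \<boxtimes> \<epsilon>) \<cdot> (i \<boxtimes> t) = i \<boxtimes> \<epsilon>"
  using Cmp_TensArr_Ident[of A t \<epsilon>] by (simp_all add: tangle_typing eps_Twist)

text \<open>
  Naturality of the twist with respect to an arrow \<open>X\<close> out of the unit: a string slides over the box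
  \<open>X\<close>, and so a string that goes once around both strings of \<open>X\<close> can be pulled off.
\<close>

lemma encircle:
  assumes X: "X \<in> Hom C (Unit C) (A \<star> A)"
  shows "(t \<boxtimes> i) \<cdot> (i \<boxtimes> t) \<cdot> (i \<boxtimes> t) \<cdot> (t \<boxtimes> i) \<cdot> (i \<boxtimes> X) = i \<boxtimes> X"
proof -
  note X = HomD[OF X]
  have over: "X \<boxtimes> i = (i \<boxtimes> t) \<cdot> (t \<boxtimes> i) \<cdot> (i \<boxtimes> X)"
    using Twist_natural'[of i X] Twist_tensor_right[OF A_Obj A_Obj A_Obj] Cmp_Ident'(2)[of "X \<boxtimes> i"]
    by (simp add: tangle_typing Twist_Unit X Cmp_assoc')
  have under: "i \<boxtimes> X = (t \<boxtimes> i) \<cdot> (i \<boxtimes> t) \<cdot> (X \<boxtimes> i)"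
    using Twist_natural'[of X i] Twist_tensor_left[OF A_Obj A_Obj A_Obj] Cmp_Ident'(2)[of "i \<boxtimes> X"]
    by (simp add: tangle_typing Twist_Unit X Cmp_assoc')
  show ?thesis
    using under unfolding over by simp
qed

definition bend :: "'m \<Rightarrow> 'm" where
  "bend X = (\<epsilon> \<boxtimes> i) \<cdot> (i \<boxtimes> X)"

text \<open>The zigzag equations let \<open>\<eta>\<close> straighten the string that has been bent.\<close>

lemma unbend:
  assumes X: "X \<in> Hom C (Unit C) (A \<star> A)"
  shows "(i \<boxtimes> bend X) \<cdot> \<eta> = X"
proof -
  note X = HomD[OF X]
  let ?ii = "Ident C (A \<star> A)"
  have ii: "?ii = i \<boxtimes> i" by (simp add: TensArr_Ident A_Obj)
  have "(i \<boxtimes> bend X) \<cdot> \<eta> = (i \<boxtimes> \<epsilon> \<boxtimes> i) \<cdot> (?ii \<boxtimes> X) \<cdot> \<eta>"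
    unfolding bend_def ii
    by (simp add: Cmp_TensArr_Ident tangle_typing X Cmp_assoc' TensArr_assoc)
  also have "(?ii \<boxtimes> X) \<cdot> \<eta> = (?ii \<boxtimes> X) \<cdot> (\<eta> \<boxtimes> Ident C (Unit C))"
    by (simp add: TensArr_Unit_right tangle_typing)
  also have "\<dots> = \<eta> \<boxtimes> X"
    using TensArr_Cmp'[of \<eta> ?ii "Ident C (Unit C)" X] Cmp_Ident'(1)[of \<eta>] Cmp_Ident'(2)[of X]
    by (simp add: tangle_typing X)
  also have "\<dots> = (\<eta> \<boxtimes> ?ii) \<cdot> (Ident C (Unit C) \<boxtimes> X)"
    using TensArr_Cmp'[of "Ident C (Unit C)" \<eta> X ?ii] Cmp_Ident'(2)[of \<eta>] Cmp_Ident'(1)[of X]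
    by (simp add: tangle_typing X)
  also have "(Ident C (Unit C) \<boxtimes> X) = X"
    by (simp add: TensArr_Unit_left X)
  also have "(i \<boxtimes> \<epsilon> \<boxtimes> i) \<cdot> (\<eta> \<boxtimes> ?ii) \<cdot> X = (((i \<boxtimes> \<epsilon>) \<cdot> (\<eta> \<boxtimes> i)) \<boxtimes> i) \<cdot> X"
    unfolding ii by (simp add: Cmp_TensArr_Ident tangle_typing X Cmp_assoc' TensArr_assoc)
  also have "\<dots> = X"
    unfolding zigzag_right using Cmp_Ident'(1)[of X] by (simp add: X TensArr_Ident A_Obj)
  finally show ?thesis .
qed

lemma bend_inject:
  assumes "X \<in> Hom C (Unit C) (A \<star> A)" "Y \<in> Hom C (Unit C) (A \<star> A)" "bend X = bend Y"
  shows "X = Y"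
  using unbend[OF assms(1)] unbend[OF assms(2)] unfolding assms(3) by simp

text \<open>
  In terms of the twists \<open>T1\<close>, \<open>T2\<close> of adjacent strings among three and the caps \<open>e1\<close>, \<open>e2\<close>
  on the first and the last two of them, introducing the encircling string turns \<open>e1 T2 T2\<close> into
  \<open>e1 (T1 T2 T2 T1) T2 T2\<close>, whose leftmost \<open>T1\<close> is the removable self-loop; sliding the cap from
  the first two strings to the last two and back uses up all other twists.
\<close>

theorem full_twist:
  assumes R: "R \<in> Hom C (Unit C) (A \<star> A)"
  shows "t \<cdot> t \<cdot> R = R"
proof -
  note R' = HomD[OF R]
  let ?T1 = "t \<boxtimes> i" and ?T2 = "i \<boxtimes> t" and ?e1 = "\<epsilon> \<boxtimes> i" and ?e2 = "i \<boxtimes> \<epsilon>" and ?Z = "i \<boxtimes> R"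
  note ty = tangle_typing R'
  have ttR: "t \<cdot> t \<cdot> R \<in> Hom C (Unit C) (A \<star> A)"
    by (rule HomI) (simp_all add: ty)
  have Z: "i \<boxtimes> (t \<cdot> t \<cdot> R) = ?T2 \<cdot> ?T2 \<cdot> ?Z"
    by (simp add: Cmp_TensArr_Ident ty)
  have "bend (t \<cdot> t \<cdot> R) = ?e1 \<cdot> ?T1 \<cdot> ?T2 \<cdot> ?T2 \<cdot> ?T1 \<cdot> ?T2 \<cdot> ?T2 \<cdot> ?Z"
    unfolding bend_def using encircle[OF ttR] unfolding Z by simp
  also have "\<dots> = (?e1 \<cdot> ?T1) \<cdot> ?T2 \<cdot> ?T2 \<cdot> ?T1 \<cdot> ?T2 \<cdot> ?T2 \<cdot> ?Z"
    by (simp add: Cmp_assoc' ty)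
  also have "\<dots> = ?e1 \<cdot> ?T2 \<cdot> (?T2 \<cdot> ?T1 \<cdot> ?T2) \<cdot> ?T2 \<cdot> ?Z"
    unfolding cap_absorbs_twist by (simp add: Cmp_assoc' ty)
  also have "\<dots> = (?e1 \<cdot> ?T2 \<cdot> ?T1) \<cdot> ?T2 \<cdot> ?T1 \<cdot> ?T2 \<cdot> ?Z"
    unfolding Yang_Baxter[symmetric] by (simp add: Cmp_assoc' ty)
  also have "\<dots> = (?e2 \<cdot> ?T2) \<cdot> ?T1 \<cdot> ?T2 \<cdot> ?Z"
    unfolding slide_cap by (simp add: Cmp_assoc' ty)
  also have "\<dots> = (?e2 \<cdot> ?T1 \<cdot> ?T2) \<cdot> ?Z"
    unfolding cap_absorbs_twist by (simp add: Cmp_assoc' ty)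
  also have "\<dots> = bend R"
    unfolding slide_cap bend_def ..
  finally show ?thesis
    by (rule bend_inject[OF ttR R])
qed

end

section \<open>Braids on two strings\<close>

text \<open>
  A layer on two strings is a tensor of layers on at most two strings, possibly with many factors on
  no strings; the induction therefore has to determine the layers on zero and one string as well.
\<close>

lemma Tangle_layer_cases:
  assumes "f \<in> braid_layers (Tangle n) Tangle_A"
  shows "\<exists>k. f \<in> Hom (Tangle n) k k \<and> (k < 2 \<longrightarrow> f = Ident (Tangle n) k) \<and>
    (k = 2 \<longrightarrow> f \<in> {Ident (Tangle n) 2, Twist (Tangle n) 1 1, tclass n (TTwistInv 1 1)})"
proof -
  let ?T = "Tangle n"
  interpret T: blocked_tangle_algebra ?T Tangle_A "Tangle_eta n" "Tangle_eps n" n "Tangle_R n" "Tangle_S n"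
    by (rule Tangle_blocked_tangle_algebra)
  show ?thesis
    using assms
  proof (induction rule: braid_layers.induct)
    case (layer_Ident k)
    show ?case by (rule exI[of _ k]) (auto simp: Tangle_Hom)
  next
    case layer_Twist
    show ?case by (rule exI[of _ 2]) (auto simp: Tangle_Hom)
  next
    case (layer_Twist_inv g)
    then have "g = tclass n (TTwistInv 1 1)"
      using T.inverse_arrows_unique Tangle_inverse_Twist[of n 1 1] by simp
    then show ?case by (intro exI[of _ 2]) (auto simp: Tangle_Hom)
  next
    case (layer_TensArr f g)
    then obtain j k where
      f: "f \<in> Hom ?T j j" "j < 2 \<longrightarrow> f = Ident ?T j"
        "j = 2 \<longrightarrow> f \<in> {Ident ?T 2, Twist ?T 1 1, tclass n (TTwistInv 1 1)}" and
      g: "g \<in> Hom ?T k k" "k < 2 \<longrightarrow> g = Ident ?T k"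
        "k = 2 \<longrightarrow> g \<in> {Ident ?T 2, Twist ?T 1 1, tclass n (TTwistInv 1 1)}"
      by blast
    have h: "f \<boxtimes>\<^bsub>?T\<^esub> g \<in> Hom ?T (j + k) (j + k)"
      using T.TensArr_Hom[OF f(1) g(1)] by simp
    have units: "j = 0 \<Longrightarrow> f \<boxtimes>\<^bsub>?T\<^esub> g = g" "k = 0 \<Longrightarrow> f \<boxtimes>\<^bsub>?T\<^esub> g = f"
      using f(2) g(2) T.TensArr_Unit_left[OF HomD(1)[OF g(1)]]
        T.TensArr_Unit_right[OF HomD(1)[OF f(1)]] by simp_all
    have ones: "f \<boxtimes>\<^bsub>?T\<^esub> g = Ident ?T 2" if "j = 1" "k = 1"
      using that f(2) g(2) T.TensArr_Ident[of 1 1] by (simp add: numeral_2_eq_2)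
    consider "j = 0" | "k = 0" | "j = 1" "k = 1" | "j + k > 2"
      by linarith
    then show ?case
    proof cases
      case 1 then show ?thesis using units(1) g by auto
    next
      case 2 then show ?thesis using units(2) f by auto
    next
      case 3 then show ?thesis using h ones by (intro exI[of _ 2]) (auto simp: numeral_2_eq_2)
    next
      case 4 then show ?thesis using h by (intro exI[of _ "j + k"]) auto
    qed
  qed
qed

text \<open>
  As \<open>\<tau>\<tau>R = R\<close>, the twist and its inverse both exchange \<open>R\<close> and \<open>\<tau>R\<close>; unlike a
  statement about \<open>BR\<close> alone, the statement about both arrows is stable under composition of braids.
\<close>

lemma two_string_braid_action:
  assumes "B \<in> Tangle_braids 2"
  defines "\<tau>R \<equiv> Twist (Tangle 2) 1 1 \<cdot>\<^bsub>Tangle 2\<^esub> Tangle_R 2"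
  shows "B \<cdot>\<^bsub>Tangle 2\<^esub> Tangle_R 2 = Tangle_R 2 \<and> B \<cdot>\<^bsub>Tangle 2\<^esub> \<tau>R = \<tau>R \<or>
    B \<cdot>\<^bsub>Tangle 2\<^esub> Tangle_R 2 = \<tau>R \<and> B \<cdot>\<^bsub>Tangle 2\<^esub> \<tau>R = Tangle_R 2"
proof -
  let ?T = "Tangle 2" and ?t = "Twist (Tangle 2) 1 1" and ?t' = "tclass 2 (TTwistInv 1 1)"
  interpret T: blocked_tangle_algebra ?T Tangle_A "Tangle_eta 2" "Tangle_eps 2" 2 "Tangle_R 2" "Tangle_S 2"
    by (rule Tangle_blocked_tangle_algebra)
  have t: "?t \<in> Hom ?T 2 2" "?t' \<in> Hom ?T 2 2"
    by (auto simp: Tangle_Hom)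
  have R: "Tangle_R 2 \<in> Hom ?T 0 2"
    using T.R_Hom by simp
  have \<tau>R: "\<tau>R \<in> Hom ?T 0 2"
    unfolding \<tau>R_def by (rule T.Cmp_Hom[OF R t(1)])
  have t\<tau>R: "?t \<cdot>\<^bsub>?T\<^esub> \<tau>R = Tangle_R 2"
    unfolding \<tau>R_def using T.full_twist[of "Tangle_R 2"] R by (simp add: numeral_2_eq_2)
  have t't: "?t' \<cdot>\<^bsub>?T\<^esub> ?t = Ident ?T 2"
    using Tangle_inverse_Twist[of 2 1 1] by (simp add: inverse_arrows_def numeral_2_eq_2)
  have t'_cancel: "?t' \<cdot>\<^bsub>?T\<^esub> ?t \<cdot>\<^bsub>?T\<^esub> X = X" if "X \<in> Hom ?T 0 2" for X
    using T.Cmp_assoc[OF that t] T.Cmp_Ident_left[OF that] unfolding t't by simp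
  have t': "?t' \<cdot>\<^bsub>?T\<^esub> \<tau>R = Tangle_R 2" "?t' \<cdot>\<^bsub>?T\<^esub> Tangle_R 2 = \<tau>R"
    using t'_cancel[OF R] t'_cancel[OF \<tau>R] unfolding t\<tau>R unfolding \<tau>R_def by simp_all
  show ?thesis
    using assms(1)
  proof (induction rule: braids.induct)
    case (braid_layer f)
    have "f \<in> {Ident ?T 2, ?t, ?t'}"
      using Tangle_layer_cases[OF braid_layer(1)] HomD(2)[OF braid_layer(2)]
      by (auto simp: Hom_def)
    then consider "f = Ident ?T 2" | "f = ?t" | "f = ?t'" by blast
    then show ?case
    proof cases
      case 1 then show ?thesis using T.Cmp_Ident_left[OF R] T.Cmp_Ident_left[OF \<tau>R] by simp
    next
      case 2 then show ?thesis using t\<tau>R \<tau>R_def by blast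
    next
      case 3 then show ?thesis using t' by blast
    qed
  next
    case (braid_Cmp f g)
    have h: "f \<in> Hom ?T 2 2" "g \<in> Hom ?T 2 2"
      using T.braids_Hom[OF braid_Cmp.hyps(1)] T.braids_Hom[OF braid_Cmp.hyps(2)] by simp_all
    show ?case
      using braid_Cmp.IH T.Cmp_assoc[OF R h] T.Cmp_assoc[OF \<tau>R h] by metis
  qed
qed

section \<open>An interpretation in relations between strings of bits\<close>

fun bit_rel :: "tangle_term \<Rightarrow> bool list \<Rightarrow> bool list \<Rightarrow> bool" where
  "bit_rel (TId a) x y \<longleftrightarrow> length x = a \<and> y = x"
| "bit_rel (TCmp g f) x z \<longleftrightarrow> (\<exists>y. bit_rel f x y \<and> bit_rel g y z)"
| "bit_rel (TTens f g) x y \<longleftrightarrow>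
    (\<exists>x1 x2 y1 y2. x = x1 @ x2 \<and> y = y1 @ y2 \<and> bit_rel f x1 y1 \<and> bit_rel g x2 y2)"
| "bit_rel (TTwist a b) x y \<longleftrightarrow> (\<exists>u v. length u = a \<and> length v = b \<and> x = u @ v \<and> y = v @ u)"
| "bit_rel (TTwistInv a b) x y \<longleftrightarrow> (\<exists>u v. length u = a \<and> length v = b \<and> x = v @ u \<and> y = u @ v)"
| "bit_rel TEta x y \<longleftrightarrow> x = [] \<and> (\<exists>b. y = [b, b])"
| "bit_rel TEps x y \<longleftrightarrow> (\<exists>b. x = [b, b]) \<and> y = []"
| "bit_rel TR x y \<longleftrightarrow> x = [] \<and> y = [False, True]"
| "bit_rel TS x y \<longleftrightarrow> x = [False, True] \<and> y = []"

text \<open>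
  Lengths match on the two sides of a composite, so that its splittings into tensor factors agree.
\<close>

lemma bit_rel_length:
  "wf_term 2 t \<Longrightarrow> bit_rel t x y \<Longrightarrow> length x = tdom 2 t \<and> length y = tcod 2 t"
proof (induction t arbitrary: x y)
  case (TCmp g f)
  then show ?case by fastforce
next
  case (TTens f g)
  then show ?case by fastforce
qed auto

lemma length_eq_add_iff: "length xs = a + b \<longleftrightarrow> (\<exists>u v. xs = u @ v \<and> length u = a \<and> length v = b)"
proof
  assume "length xs = a + b"
  then show "\<exists>u v. xs = u @ v \<and> length u = a \<and> length v = b"
    by (intro exI[of _ "take a xs"] exI[of _ "drop a xs"]) simp
qed auto

lemma length_1_iff: "length xs = Suc 0 \<longleftrightarrow> (\<exists>x. xs = [x])"
  by (cases xs) auto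

lemma bit_rel_Twist_1_1: "bit_rel (TTwist 1 1) x y \<longleftrightarrow> (\<exists>b c. x = [b, c] \<and> y = [c, b])"
proof
  assume "\<exists>b c. x = [b, c] \<and> y = [c, b]"
  then obtain b c where "x = [b] @ [c]" "y = [c] @ [b]" by auto
  then show "bit_rel (TTwist 1 1) x y"
    unfolding bit_rel.simps by (intro exI[of _ "[b]"] exI[of _ "[c]"]) simp
qed (auto simp: length_1_iff)

lemma bit_rel_cong:
  "tangle_eq 2 t u \<Longrightarrow> bit_rel t = bit_rel u"
proof (induction rule: tangle_eq.induct)
  case (Id_left f)
  then show ?case using bit_rel_length by (fastforce simp: fun_eq_iff)
next
  case (Id_right f)
  then show ?case using bit_rel_length by (fastforce simp: fun_eq_iff)
next
  case (Cmp_assoc f g h)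
  show ?case by (auto simp: fun_eq_iff)
next
  case (Tens_Id a b)
  show ?case
    by (intro ext iffI; simp add: length_eq_add_iff; blast)
next
  case (Tens_Cmp f g f' g')
  show ?case
  proof (intro ext iffI)
    fix x z
    assume "bit_rel (TTens (TCmp g f) (TCmp g' f')) x z"
    then show "bit_rel (TCmp (TTens g g') (TTens f f')) x z"
      by simp blast
  next
    fix x z
    assume "bit_rel (TCmp (TTens g g') (TTens f f')) x z"
    then obtain x1 x2 y1 y2 y1' y2' z1 z2 where e: "x = x1 @ x2" "z = z1 @ z2" "y1' @ y2' = y1 @ y2"
      and r: "bit_rel f x1 y1" "bit_rel f' x2 y2" "bit_rel g y1' z1" "bit_rel g' y2' z2"
      by auto
    have "length y1 = length y1'"
      using Tens_Cmp r bit_rel_length by metis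
    then have "y1 = y1'" "y2 = y2'"
      using e(3) by simp_all
    then show "bit_rel (TTens (TCmp g f) (TCmp g' f')) x z"
      using e r unfolding bit_rel.simps by blast
  qed
next
  case (Tens_assoc f g h)
  show ?case
  proof (intro ext iffI)
    fix x y
    assume "bit_rel (TTens (TTens f g) h) x y"
    then obtain x1 x2 x3 y1 y2 y3 where
      "x = x1 @ x2 @ x3" "y = y1 @ y2 @ y3" "bit_rel f x1 y1" "bit_rel g x2 y2" "bit_rel h x3 y3"
      by auto
    then show "bit_rel (TTens f (TTens g h)) x y" unfolding bit_rel.simps by blast
  next
    fix x y
    assume "bit_rel (TTens f (TTens g h)) x y"
    then obtain x1 x2 x3 y1 y2 y3 where
      "x = (x1 @ x2) @ x3" "y = (y1 @ y2) @ y3" "bit_rel f x1 y1" "bit_rel g x2 y2" "bit_rel h x3 y3"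
      by auto
    then show "bit_rel (TTens (TTens f g) h) x y" unfolding bit_rel.simps by blast
  qed
next
  case (Tens_unit_left f)
  have "bit_rel (TTens (TId 0) f) x y \<longleftrightarrow> bit_rel f x y" for x y
    unfolding bit_rel.simps(1,3) length_0_conv by (metis append_Nil)
  then show ?case by (intro ext)
next
  case (Tens_unit_right f)
  have "bit_rel (TTens f (TId 0)) x y \<longleftrightarrow> bit_rel f x y" for x y
    unfolding bit_rel.simps(1,3) length_0_conv by (metis append_Nil2)
  then show ?case by (intro ext)
next
  case (Twist_inv_left a b)
  show ?case
  proof (intro ext iffI)
    fix x z
    assume "bit_rel (TCmp (TTwistInv a b) (TTwist a b)) x z"
    then obtain y where y: "bit_rel (TTwist a b) x y" "bit_rel (TTwistInv a b) y z"
      unfolding bit_rel.simps(2) by blast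
    obtain u v where uv: "length u = a" "length v = b" "x = u @ v" "y = v @ u"
      using y(1) unfolding bit_rel.simps by blast
    obtain u' v' where uv': "length u' = a" "length v' = b" "y = v' @ u'" "z = u' @ v'"
      using y(2) unfolding bit_rel.simps by blast
    have "u' = u" "v' = v"
      using uv(1,2,4) uv'(1,2,3) by (metis append_eq_append_conv)+
    then show "bit_rel (TId (a + b)) x z"
      using uv uv' by simp
  next
    fix x z
    assume "bit_rel (TId (a + b)) x z"
    then obtain u v where "x = u @ v" "z = x" "length u = a" "length v = b"
      by (auto simp: length_eq_add_iff)
    then show "bit_rel (TCmp (TTwistInv a b) (TTwist a b)) x z"
      unfolding bit_rel.simps by blast
  qed
next
  case (Twist_inv_right a b)
  show ?case
  proof (intro ext iffI)
    fix x z
    assume "bit_rel (TCmp (TTwist a b) (TTwistInv a b)) x z"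
    then obtain y where y: "bit_rel (TTwistInv a b) x y" "bit_rel (TTwist a b) y z"
      unfolding bit_rel.simps(2) by blast
    obtain u v where uv: "length u = a" "length v = b" "x = v @ u" "y = u @ v"
      using y(1) unfolding bit_rel.simps by blast
    obtain u' v' where uv': "length u' = a" "length v' = b" "y = u' @ v'" "z = v' @ u'"
      using y(2) unfolding bit_rel.simps by blast
    have "u' = u" "v' = v"
      using uv(1,2,4) uv'(1,2,3) by (metis append_eq_append_conv)+
    then show "bit_rel (TId (b + a)) x z"
      using uv uv' by simp
  next
    fix x z
    assume "bit_rel (TId (b + a)) x z"
    then obtain u v where "x = v @ u" "z = x" "length u = a" "length v = b"
      by (auto simp: length_eq_add_iff)
    then show "bit_rel (TCmp (TTwist a b) (TTwistInv a b)) x z"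
      unfolding bit_rel.simps by blast
  qed
next
  case (Twist_natural f g)
  show ?case
  proof (intro ext iffI)
    fix x z
    assume "bit_rel (TCmp (TTens g f) (TTwist (tdom 2 f) (tdom 2 g))) x z"
    then obtain u v u' v' z1 z2 where e: "x = u @ v" "v' @ u' = v @ u" "z = z1 @ z2"
      and l: "length u = tdom 2 f" "length v = tdom 2 g"
      and r: "bit_rel g v' z1" "bit_rel f u' z2"
      by auto
    have "length v' = length v"
      using bit_rel_length Twist_natural r l by metis
    then have "v' = v" "u' = u" using e(2) by simp_all
    moreover have "length z2 = tcod 2 f" "length z1 = tcod 2 g"
      using bit_rel_length Twist_natural r by blast+
    ultimately show "bit_rel (TCmp (TTwist (tcod 2 f) (tcod 2 g)) (TTens f g)) x z"
      using e r unfolding bit_rel.simps by blast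
  next
    fix x z
    assume "bit_rel (TCmp (TTwist (tcod 2 f) (tcod 2 g)) (TTens f g)) x z"
    then obtain x1 x2 y1 y2 u v where e: "x = x1 @ x2" "y1 @ y2 = u @ v" "z = v @ u"
      and l: "length u = tcod 2 f" "length v = tcod 2 g"
      and r: "bit_rel f x1 y1" "bit_rel g x2 y2"
      by auto
    have "length y1 = length u"
      using bit_rel_length Twist_natural r l by metis
    then have "y1 = u" "y2 = v" using e(2) by simp_all
    moreover have "length x1 = tdom 2 f" "length x2 = tdom 2 g"
      using bit_rel_length Twist_natural r by blast+
    ultimately show "bit_rel (TCmp (TTens g f) (TTwist (tdom 2 f) (tdom 2 g))) x z"
      using e r unfolding bit_rel.simps by blast
  qed
next
  case (Twist_tensor_right a b c)
  show ?case
  proof (intro ext iffI)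
    fix x z
    assume "bit_rel (TTwist a (b + c)) x z"
    then obtain u v w where "x = (u @ v) @ w" "z = v @ w @ u" "length u = a" "length v = b" "length w = c"
      unfolding bit_rel.simps length_eq_add_iff by auto
    then show "bit_rel (TCmp (TTens (TId b) (TTwist a c)) (TTens (TTwist a b) (TId c))) x z"
      unfolding bit_rel.simps by (intro exI[of _ "v @ u @ w"]) (metis append.assoc)
  next
    fix x z
    assume "bit_rel (TCmp (TTens (TId b) (TTwist a c)) (TTens (TTwist a b) (TId c))) x z"
    then obtain y where y: "bit_rel (TTens (TTwist a b) (TId c)) x y" "bit_rel (TTens (TId b) (TTwist a c)) y z"
      unfolding bit_rel.simps(2) by blast
    obtain p q w where pq: "x = p @ w" "y = q @ w" "length w = c" "bit_rel (TTwist a b) p q"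
      using y(1) unfolding bit_rel.simps(1,3) by blast
    obtain u v where uv: "length u = a" "length v = b" "p = u @ v" "q = v @ u"
      using pq(4) unfolding bit_rel.simps by blast
    obtain p' q' v' where pq': "y = v' @ p'" "z = v' @ q'" "length v' = b" "bit_rel (TTwist a c) p' q'"
      using y(2) unfolding bit_rel.simps(1,3) by blast
    obtain u' w' where uw': "length u' = a" "length w' = c" "p' = u' @ w'" "q' = w' @ u'"
      using pq'(4) unfolding bit_rel.simps by blast
    have "v' @ u' @ w' = v @ u @ w"
      using pq(2) uv(4) pq'(1) uw'(3) by simp
    then have "v' = v" "u' = u" "w' = w"
      using uv(1,2) pq(3) pq'(3) uw'(1,2) by (metis append_eq_append_conv)+
    then have "x = u @ v @ w" "z = (v @ w) @ u" "length u = a" "length v = b" "length w = c"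
      using pq uv pq' uw' by simp_all
    then show "bit_rel (TTwist a (b + c)) x z"
      unfolding bit_rel.simps by (metis length_append)
  qed
next
  case (Twist_tensor_left a b c)
  show ?case
  proof (intro ext iffI)
    fix x z
    assume "bit_rel (TTwist (a + b) c) x z"
    then obtain u v w where "x = u @ v @ w" "z = (w @ u) @ v" "length u = a" "length v = b" "length w = c"
      unfolding bit_rel.simps length_eq_add_iff by auto
    then show "bit_rel (TCmp (TTens (TTwist a c) (TId b)) (TTens (TId a) (TTwist b c))) x z"
      unfolding bit_rel.simps by (intro exI[of _ "u @ w @ v"]) (metis append.assoc)
  next
    fix x z
    assume "bit_rel (TCmp (TTens (TTwist a c) (TId b)) (TTens (TId a) (TTwist b c))) x z"
    then obtain y where y: "bit_rel (TTens (TId a) (TTwist b c)) x y" "bit_rel (TTens (TTwist a c) (TId b)) y z"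
      unfolding bit_rel.simps(2) by blast
    obtain p q u where pq: "x = u @ p" "y = u @ q" "length u = a" "bit_rel (TTwist b c) p q"
      using y(1) unfolding bit_rel.simps(1,3) by blast
    obtain v w where vw: "length v = b" "length w = c" "p = v @ w" "q = w @ v"
      using pq(4) unfolding bit_rel.simps by blast
    obtain p' q' v' where pq': "y = p' @ v'" "z = q' @ v'" "length v' = b" "bit_rel (TTwist a c) p' q'"
      using y(2) unfolding bit_rel.simps(1,3) by blast
    obtain u' w' where uw': "length u' = a" "length w' = c" "p' = u' @ w'" "q' = w' @ u'"
      using pq'(4) unfolding bit_rel.simps by blast
    have "u' @ w' @ v' = u @ w @ v"
      using pq(2) vw(4) pq'(1) uw'(3) by simp
    then have "v' = v" "u' = u" "w' = w"
      using vw(1,2) pq(3) pq'(3) uw'(1,2) by (metis append_eq_append_conv)+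
    then have "x = (u @ v) @ w" "z = w @ u @ v" "length u = a" "length v = b" "length w = c"
      using pq vw pq' uw' by simp_all
    then show "bit_rel (TTwist (a + b) c) x z"
      unfolding bit_rel.simps by (metis length_append)
  qed
next
  case Zigzag_left
  show ?case
  proof (intro ext iffI)
    fix x z
    assume "bit_rel (TCmp (TTens TEps (TId 1)) (TTens (TId 1) TEta)) x z"
    then show "bit_rel (TId 1) x z"
      by (auto simp: length_1_iff Cons_eq_append_conv append_eq_Cons_conv)
  next
    fix x z
    assume "bit_rel (TId 1) x z"
    then obtain b where b: "x = [b]" "z = [b]"
      by (auto simp: length_1_iff)
    have "bit_rel (TTens (TId 1) TEta) [b] [b, b, b]"
      unfolding bit_rel.simps by (intro exI[of _ "[b]"] exI[of _ "[]"] exI[of _ "[b]"] exI[of _ "[b, b]"]) simp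
    moreover have "bit_rel (TTens TEps (TId 1)) [b, b, b] [b]"
      unfolding bit_rel.simps by (intro exI[of _ "[b, b]"] exI[of _ "[b]"] exI[of _ "[]"] exI[of _ "[b]"]) simp
    ultimately show "bit_rel (TCmp (TTens TEps (TId 1)) (TTens (TId 1) TEta)) x z"
      unfolding b bit_rel.simps(2) by blast
  qed
next
  case Zigzag_right
  show ?case
  proof (intro ext iffI)
    fix x z
    assume "bit_rel (TCmp (TTens (TId 1) TEps) (TTens TEta (TId 1))) x z"
    then show "bit_rel (TId 1) x z"
      by (auto simp: length_1_iff Cons_eq_append_conv append_eq_Cons_conv)
  next
    fix x z
    assume "bit_rel (TId 1) x z"
    then obtain b where b: "x = [b]" "z = [b]"
      by (auto simp: length_1_iff)
    have "bit_rel (TTens TEta (TId 1)) [b] [b, b, b]"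
      unfolding bit_rel.simps by (intro exI[of _ "[]"] exI[of _ "[b]"] exI[of _ "[b, b]"] exI[of _ "[b]"]) simp
    moreover have "bit_rel (TTens (TId 1) TEps) [b, b, b] [b]"
      unfolding bit_rel.simps by (intro exI[of _ "[b]"] exI[of _ "[b, b]"] exI[of _ "[b]"] exI[of _ "[]"]) simp
    ultimately show "bit_rel (TCmp (TTens (TId 1) TEps) (TTens TEta (TId 1))) x z"
      unfolding b bit_rel.simps(2) by blast
  qed
next
  case Eps_Twist
  show ?case by (intro ext) (auto simp only: bit_rel.simps(2,6,7) bit_rel_Twist_1_1 list.inject)
next
  case Twist_Eta
  show ?case by (intro ext) (auto simp only: bit_rel.simps(2,6,7) bit_rel_Twist_1_1 list.inject)
qed (auto simp: fun_eq_iff)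

lemma blocked_twist_neq_one:
  "blocked 2 (Twist (Tangle 2) 1 1) \<noteq> blocked 2 (Ident (Tangle 2) 2)"
proof
  assume "blocked 2 (Twist (Tangle 2) 1 1) = blocked 2 (Ident (Tangle 2) 2)"
  then have "tangle_eq 2 (TCmp TS (TCmp (TTwist 1 1) TR)) (TCmp TS (TCmp (TId 2) TR))"
    by (simp add: blocked_def Tangle_S_def Tangle_R_def tclass_eq_iff)
  then have "bit_rel (TCmp TS (TCmp (TTwist 1 1) TR)) = bit_rel (TCmp TS (TCmp (TId 2) TR))"
    by (rule bit_rel_cong)
  moreover have "bit_rel (TCmp TS (TCmp (TId 2) TR)) [] []"
    by simp
  moreover have "\<not> bit_rel (TCmp TS (TCmp (TTwist 1 1) TR)) [] []"
    by (auto simp: length_1_iff)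
  ultimately show False
    by metis
qed

section \<open>The blocked-braid group on two strings\<close>

lemma (in group) two_element_group_iso:
  assumes carrier: "carrier G = {\<one>, a}" and a: "a \<noteq> \<one>"
  shows "G \<cong> integer_mod_group 2"
proof -
  have aG: "a \<in> carrier G" using carrier by simp
  have "a \<otimes> a \<noteq> a" using a aG by simp
  then have aa: "a \<otimes> a = \<one>" using m_closed[OF aG aG] carrier by simp
  have "(\<lambda>x. if x = \<one> then 0 else 1 :: int) \<in> iso G (integer_mod_group 2)"
    unfolding iso_def hom_def bij_betw_def
    using a aa aG by (auto simp: carrier carrier_integer_mod_group inj_on_def)
  then show ?thesis by (rule is_isoI)
qed

lemma BB_2_carrier:
  "carrier (BB 2) = {\<one>\<^bsub>BB 2\<^esub>, blocked 2 (Twist (Tangle 2) 1 1)}"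
proof -
  let ?T = "Tangle 2"
  interpret T: blocked_tangle_algebra ?T Tangle_A "Tangle_eta 2" "Tangle_eps 2" 2 "Tangle_R 2" "Tangle_S 2"
    by (rule Tangle_blocked_tangle_algebra)
  have one: "\<one>\<^bsub>BB 2\<^esub> = Tangle_S 2 \<cdot>\<^bsub>?T\<^esub> Tangle_R 2"
    unfolding BB_one blocked_def using T.Cmp_Ident_left[OF T.R_Hom] by simp
  have tw: "Twist ?T 1 1 \<in> Tangle_braids 2"
    using braids.braid_layer[OF braid_layers.layer_Twist, of ?T 1 2] by (simp add: Tangle_Hom)
  show ?thesis
  proof
    have "blocked 2 B \<in> {\<one>\<^bsub>BB 2\<^esub>, blocked 2 (Twist ?T 1 1)}" if "B \<in> Tangle_braids 2" for B
      unfolding one blocked_def using two_string_braid_action[OF that] by (elim disjE conjE) simp_all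
    then show "carrier (BB 2) \<subseteq> {\<one>\<^bsub>BB 2\<^esub>, blocked 2 (Twist ?T 1 1)}"
      unfolding BB_carrier by blast
    have "\<one>\<^bsub>BB 2\<^esub> \<in> carrier (BB 2)"
      using BB_group by (simp add: group.is_monoid)
    then show "{\<one>\<^bsub>BB 2\<^esub>, blocked 2 (Twist ?T 1 1)} \<subseteq> carrier (BB 2)"
      using tw by (simp add: BB_carrier)
  qed
qed

theorem mainTheorem3:
  shows "BB 2 \<cong> integer_mod_group 2"
  using group.two_element_group_iso[OF BB_group BB_2_carrier] blocked_twist_neq_one
  by (simp add: BB_one)

end
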